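(* Let $\Phi$ be a real, additive gain graph on $n$ vertices and assume $n>d\geq 1$. Then the set of $n$-tuples $\mathbf{Q}=(Q_1,\dots,Q_n)\in(\mathbb{E}^d)^n$ that have ideal general position, general position with respect to $\Phi$, and projective general position with respect to $\Phi$ contains an open dense subset of $(\mathbb{E}^d)^n$.
   Context: A real, additive gain graph $\Phi$ on $V=\{1,\dots,n\}$: finite graph with edge set $E$ (multiple edges allowed, every edge with two distinct endpoints) and gains $\phi(e;i,j)\in\mathbb{R}$ with $\phi(e;j,i)=-\phi(e;i,j)$. $S\subseteq E$ is balanced if every circle in $S$ has gain sum $0$ (read consistently around the circle); $c(S)$ is the number of components of $(V,S)$, isolated vertices included. With $\psi_{ij}(P)=d(P,Q_i)^2-d(P,Q_j)^2$, the Pythagorean arrangement $\mathcal{H}=\mathcal{H}(\Phi;\mathbf{Q})$ consists of the hyperplanes $h(e)=\{P\in\mathbb{E}^d:\psi_{ij}(P)=\phi(e;i,j)\}$ for edges $e$ with endpoints $i,j$ (defined when $Q_i\neq Q_j$ for adjacent $i,j$). $\mathcal{L}(\mathcal{H})$ is the set of nonempty intersections of subsets of $\mathcal{H}$ (including $\mathbb{E}^d$), ordered by reverse inclusion; for $s\in\mathcal{L}(\mathcal{H})$, $E(s)=\{e:h(e)\supseteq s\}$. Balanced flats: a balanced $S\subseteq E$ is a balanced flat if every $e\in E\setminus S$ with both endpoints in one component of $(V,S)$ makes $S\cup\{e\}$ unbalanced; its rank is $n-c(S)$. $[\mathrm{Lat}^b\Phi]_0^d$ is the poset (under inclusion) of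 balanced flats of rank at most $d$. Complete lift matroid $L_0(\Phi)$: ground set $E\cup\{e_0\}$ ($e_0\notin E$), rank function $r(S)=n-c(S\setminus\{e_0\})+\epsilon$, where $\epsilon=0$ if $S$ is a balanced subset of $E$ and $\epsilon=1$ otherwise; $\mathrm{Lat}\,L_0(\Phi)$ is its lattice of flats and $T_{d+1}(\mathrm{Lat}\,L_0(\Phi))$ its truncation, in which all flats of rank $\geq d+1$ are replaced by the single top element $E\cup\{e_0\}$. Ideal general position (IGP): the points are distinct and, embedding $\mathbb{E}^d\subset\mathbb{P}^d$ with ideal hyperplane $h_\infty$ and letting $p_{ij}$ be the ideal point of line $Q_iQ_j$, for every set $T$ of unordered pairs $\{i,j\}$ the projective span of $\{p_{ij}:\{i,j\}\in T\}$ has dimension $\min(n-c(T),d)-1$, where $c(T)$ counts components of the graph $(\{1,\dots,n\},T)$. General position with respect to $\Phi$ (GP): $\mathcal{H}(\Phi;\mathbf{Q})$ is defined and $s\mapsto E(s)$ is a poset isomorphism from $\mathcal{L}(\mathcal{H})$ onto $[\mathrm{Lat}^b\Phi]_0^d$. Projective general position with respect to $\Phi$ (PGP): with $\mathcal{H}_{\mathbb{P}}=\{h(e)_{\mathbb{P}}:e\in E\}\cup\{h_\infty\}$ ($h_{\mathbb{P}}$ = projective closure), the lattice $\mathcal{L}(\mathcal{H}_{\mathbb{P}})$ of all intersections of subsets of $\mathcal{H}_{\mathbb{P}}$ in $\mathbb{P}^d$ (ordered by reverse inclusion) is isomorphic to $T_{d+1}(\mathrm{Lat}\,L_0(\Phi))$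 via $x\mapsto\{e\in E:h(e)_{\mathbb{P}}\supseteq x\}\cup\{e_0: h_\infty\supseteq x\}$. *)

theory Defs
  imports "HOL-Analysis.Analysis"
begin

text \<open>A real additive gain graph on the vertex type 'n (n = CARD('n)):
  a finite edge set E :: 'e set, an endpoint function ends (ends e = (i,j) with i \<noteq> j),
  and gains g e = phi(e;i,j) where (i,j) = ends e; phi(e;j,i) = - g e.\<close>

definition phi :: "('e \<Rightarrow> 'n \<times> 'n) \<Rightarrow> ('e \<Rightarrow> real) \<Rightarrow> 'e \<Rightarrow> 'n \<Rightarrow> 'n \<Rightarrow> real" where
  "phi ends g e i j = (if (i, j) = ends e then g e else - g e)"

text \<open>A circle in S: distinct vertices vs!0,...,vs!(k-1), distinct edges es!0,...,es!(k-1)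
  (k \<ge> 2) in S, edge es!m joining vs!m and vs!((m+1) mod k).\<close>
definition is_circle :: "('e \<Rightarrow> 'n \<times> 'n) \<Rightarrow> 'e set \<Rightarrow> 'n list \<Rightarrow> 'e list \<Rightarrow> bool" where
  "is_circle ends S vs es \<longleftrightarrow>
     length vs = length es \<and> 2 \<le> length es \<and> distinct vs \<and> distinct es \<and> set es \<subseteq> S \<and>
     (\<forall>m<length es. ends (es ! m) = (vs ! m, vs ! ((m + 1) mod length es)) \<or>
                     ends (es ! m) = (vs ! ((m + 1) mod length es), vs ! m))"

definition balanced :: "('e \<Rightarrow> 'n \<times> 'n) \<Rightarrow> ('e \<Rightarrow> real) \<Rightarrow> 'e set \<Rightarrow> bool" where
  "balanced ends g S \<longleftrightarrow>
     (\<forall>vs es. is_circle ends S vs es \<longrightarrow>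
        (\<Sum>m<length es. phi ends g (es ! m) (vs ! m) (vs ! ((m + 1) mod length es))) = 0)"

text \<open>Number of connected components of the graph (UNIV, A), isolated vertices included.\<close>
definition ncomp :: "('n::finite \<times> 'n) set \<Rightarrow> nat" where
  "ncomp A = card (UNIV // ((A \<union> A\<inverse>)\<^sup>*))"

definition balanced_flat :: "'e set \<Rightarrow> ('e \<Rightarrow> 'n::finite \<times> 'n) \<Rightarrow> ('e \<Rightarrow> real) \<Rightarrow> 'e set \<Rightarrow> bool" where
  "balanced_flat E ends g S \<longleftrightarrow> S \<subseteq> E \<and> balanced ends g S \<and>
     (\<forall>e\<in>E - S. ends e \<in> ((ends ` S) \<union> (ends ` S)\<inverse>)\<^sup>* \<longrightarrow> \<not> balanced ends g (insert e S))"

section \<open>Pythagorean arrangement\<close>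

definition hyp :: "('e \<Rightarrow> 'n \<times> 'n) \<Rightarrow> ('e \<Rightarrow> real) \<Rightarrow> real^'d^'n \<Rightarrow> 'e \<Rightarrow> (real^'d) set" where
  "hyp ends g Q e = {P. (dist P (Q $ fst (ends e)))\<^sup>2 - (dist P (Q $ snd (ends e)))\<^sup>2
                         = phi ends g e (fst (ends e)) (snd (ends e))}"

definition arr_defined :: "'e set \<Rightarrow> ('e \<Rightarrow> 'n \<times> 'n) \<Rightarrow> real^'d^'n \<Rightarrow> bool" where
  "arr_defined E ends Q \<longleftrightarrow> (\<forall>e\<in>E. Q $ fst (ends e) \<noteq> Q $ snd (ends e))"

text \<open>L(H): nonempty intersections of subsets of H (the empty subset gives the whole space).\<close>
definition LH :: "'e set \<Rightarrow> ('e \<Rightarrow> 'n \<times> 'n) \<Rightarrow> ('e \<Rightarrow> real) \<Rightarrow> real^'d^'n \<Rightarrow> (real^'d) set set" where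
  "LH E ends g Q = {\<Inter>F | F. F \<subseteq> hyp ends g Q ` E \<and> \<Inter>F \<noteq> {}}"

definition Esub :: "'e set \<Rightarrow> ('e \<Rightarrow> 'n \<times> 'n) \<Rightarrow> ('e \<Rightarrow> real) \<Rightarrow> real^'d^'n \<Rightarrow> (real^'d) set \<Rightarrow> 'e set" where
  "Esub E ends g Q s = {e\<in>E. s \<subseteq> hyp ends g Q e}"

text \<open>General position with respect to the gain graph: s \<mapsto> E(s) is a poset isomorphism from
  L(H) (reverse inclusion) onto the balanced flats of rank \<le> d (inclusion).\<close>
definition GP :: "'e set \<Rightarrow> ('e \<Rightarrow> 'n::finite \<times> 'n) \<Rightarrow> ('e \<Rightarrow> real) \<Rightarrow> real^'d^'n \<Rightarrow> bool" where
  "GP E ends g Q \<longleftrightarrow> arr_defined E ends Q \<and>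
     bij_betw (Esub E ends g Q) (LH E ends g Q)
       {S. balanced_flat E ends g S \<and> CARD('n) - ncomp (ends ` S) \<le> CARD('d)} \<and>
     (\<forall>s\<in>LH E ends g Q. \<forall>t\<in>LH E ends g Q. t \<subseteq> s \<longleftrightarrow> Esub E ends g Q s \<subseteq> Esub E ends g Q t)"

section \<open>Complete lift matroid; the extra element e0 is None, edges e are Some e\<close>

definition ground :: "'e set \<Rightarrow> 'e option set" where
  "ground E = insert None (Some ` E)"

definition lift_rank :: "('e \<Rightarrow> 'n::finite \<times> 'n) \<Rightarrow> ('e \<Rightarrow> real) \<Rightarrow> 'e option set \<Rightarrow> nat" where
  "lift_rank ends g S = CARD('n) - ncomp (ends ` {e. Some e \<in> S})
      + (if None \<notin> S \<and> balanced ends g {e. Some e \<in> S} then 0 else 1)"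

definition flat_L0 :: "'e set \<Rightarrow> ('e \<Rightarrow> 'n::finite \<times> 'n) \<Rightarrow> ('e \<Rightarrow> real) \<Rightarrow> 'e option set \<Rightarrow> bool" where
  "flat_L0 E ends g F \<longleftrightarrow> F \<subseteq> ground E \<and>
     (\<forall>x\<in>ground E - F. lift_rank ends g (insert x F) > lift_rank ends g F)"

text \<open>Truncation T_{k}(Lat L0): flats of rank < k, together with the top element.\<close>
definition trunc_L0 :: "nat \<Rightarrow> 'e set \<Rightarrow> ('e \<Rightarrow> 'n::finite \<times> 'n) \<Rightarrow> ('e \<Rightarrow> real) \<Rightarrow> 'e option set set" where
  "trunc_L0 k E ends g = {F. flat_L0 E ends g F \<and> lift_rank ends g F < k} \<union> {ground E}"

section \<open>Projective closure: P^d modelled by homogeneous coordinates in R^d \<times> R;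
  projective subspaces are linear subspaces (the empty projective set is {0}).\<close>

definition pclos :: "(real^'d) set \<Rightarrow> ((real^'d) \<times> real) set" where
  "pclos A = span ((\<lambda>P. (P, 1)) ` A)"

definition hinf :: "((real^'d) \<times> real) set" where
  "hinf = {x. snd x = 0}"

definition HP :: "'e set \<Rightarrow> ('e \<Rightarrow> 'n \<times> 'n) \<Rightarrow> ('e \<Rightarrow> real) \<Rightarrow> real^'d^'n \<Rightarrow> ((real^'d) \<times> real) set set" where
  "HP E ends g Q = insert hinf ((\<lambda>e. pclos (hyp ends g Q e)) ` E)"

definition LP :: "'e set \<Rightarrow> ('e \<Rightarrow> 'n \<times> 'n) \<Rightarrow> ('e \<Rightarrow> real) \<Rightarrow> real^'d^'n \<Rightarrow> ((real^'d) \<times> real) set set" where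
  "LP E ends g Q = {\<Inter>F | F. F \<subseteq> HP E ends g Q}"

definition Pmap :: "'e set \<Rightarrow> ('e \<Rightarrow> 'n \<times> 'n) \<Rightarrow> ('e \<Rightarrow> real) \<Rightarrow> real^'d^'n \<Rightarrow> ((real^'d) \<times> real) set \<Rightarrow> 'e option set" where
  "Pmap E ends g Q x = Some ` {e\<in>E. x \<subseteq> pclos (hyp ends g Q e)} \<union> (if x \<subseteq> hinf then {None} else {})"

definition PGP :: "'e set \<Rightarrow> ('e \<Rightarrow> 'n::finite \<times> 'n) \<Rightarrow> ('e \<Rightarrow> real) \<Rightarrow> real^'d^'n \<Rightarrow> bool" where
  "PGP E ends g Q \<longleftrightarrow> arr_defined E ends Q \<and>
     bij_betw (Pmap E ends g Q) (LP E ends g Q) (trunc_L0 (CARD('d) + 1) E ends g) \<and>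
     (\<forall>x\<in>LP E ends g Q. \<forall>y\<in>LP E ends g Q. y \<subseteq> x \<longleftrightarrow> Pmap E ends g Q x \<subseteq> Pmap E ends g Q y)"

section \<open>Ideal general position\<close>

text \<open>Homogeneous coordinates of the ideal points p_ij of the lines Q_i Q_j, {i,j} \<in> T.\<close>
definition ideal_pts :: "real^'d^'n \<Rightarrow> 'n set set \<Rightarrow> ((real^'d) \<times> real) set" where
  "ideal_pts Q T = {(Q $ j - Q $ i, 0) | i j. {i, j} \<in> T \<and> i \<noteq> j}"

definition IGP :: "real^'d^'n::finite \<Rightarrow> bool" where
  "IGP Q \<longleftrightarrow> inj (($) Q) \<and>
     (\<forall>T :: 'n set set. (\<forall>t\<in>T. card t = 2) \<longrightarrow>
        int (dim (span (ideal_pts Q T))) - 1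
          = min (int (CARD('n) - ncomp {(i, j). {i, j} \<in> T})) (int CARD('d)) - 1)"

end

theory Submission
  imports Defs
begin

text \<open>Assign to each edge \<open>e\<close> from \<open>i\<close> to \<open>j\<close> the vector \<open>e\<^sub>j - e\<^sub>i - g e \<cdot> e\<^sub>0\<close> and to the extra element the
  vector \<open>e\<^sub>0\<close>; these vectors represent the complete lift matroid. A linear map \<open>L\<^sub>Q\<close> to \<open>\<real>\<^sup>d \<times> \<real>\<close>,
  polynomial in \<open>Q\<close>, sends them to the normal vectors of the projective hyperplanes. For a fixed
  subspace \<open>X\<close> spanned by such vectors, \<open>dim (L\<^sub>Q X) = min (dim X) (d + 1)\<close> is the non-vanishing of a
  polynomial in \<open>Q\<close>, so it holds on an open dense set as soon as it holds for one \<open>Q\<close>. Once these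
  dimensions are right for all subsets of the ground set, the intersection lattices are read off
  by orthogonality.\<close>

section \<open>Generic properties\<close>

text \<open>The obstacle is to find one good \<open>Q\<close>. The first \<open>d\<close>
  coordinates of the linear map depend linearly on \<open>Q\<close>, so they can be made injective
  on any prescribed subspace of the vertex space of dimension at most \<open>d\<close>. When the
  vertex parts have dimension \<open>d + 1\<close>, some linear relation between the points must
  remain, and the last coordinate has to detect it; but that coordinate contains the squared norms
  of the same points and cannot be chosen independently. A relation \<open>Q_i = Q_j\<close> on two
  vertices also equates the norms, so moving the points would have no effect on the last coordinate.
  The vertex coordinates of all vectors in question sum to zero, however, which forces every space
  of vertex parts of dimension at least 2 to contain a relation on three or more vertices; such a
  relation leaves room to move the points. Ideal general position concerns only the linear part, for
  all pairs of vertices instead of the edges, and is obtained separately; the distinctness of the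
  points that it contains makes every \<open>h(e)\<close> defined.\<close>

definition generically :: "('q::topological_space \<Rightarrow> bool) \<Rightarrow> bool" where
  "generically P \<longleftrightarrow> (\<exists>U. open U \<and> closure U = UNIV \<and> U \<subseteq> Collect P)"

lemma generically_True: "generically (\<lambda>_. True)"
  unfolding generically_def by (intro exI [of _ UNIV]) auto

lemma generically_mono: "generically P \<Longrightarrow> (\<And>Q. P Q \<Longrightarrow> P' Q) \<Longrightarrow> generically P'"
  unfolding generically_def by blast

lemma generically_conj:
  assumes "generically P" "generically P'"
  shows "generically (\<lambda>Q. P Q \<and> P' Q)"
proof -
  obtain U U' where U: "open U" "closure U = UNIV" "U \<subseteq> Collect P"
    and U': "open U'" "closure U' = UNIV" "U' \<subseteq> Collect P'"
    using assms unfolding generically_def by blast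
  have "closure (U \<inter> U') = UNIV"
    using closure_open_Int_superset [of U U'] U U' by auto
  then show ?thesis
    unfolding generically_def using U U' by (intro exI [of _ "U \<inter> U'"]) auto
qed

lemma generically_ball_finite:
  assumes "finite I" "\<And>i. i \<in> I \<Longrightarrow> generically (P i)"
  shows "generically (\<lambda>Q. \<forall>i\<in>I. P i Q)"
  using assms
proof (induction I rule: finite_induct)
  case (insert i I)
  then have "generically (\<lambda>Q. P i Q \<and> (\<forall>j\<in>I. P j Q))"
    by (intro generically_conj) auto
  then show ?case by (rule generically_mono) auto
qed (simp add: generically_True)

text \<open>On the line through \<open>Q\<close> and \<open>Q0\<close> the polynomial becomes one in
  a single variable. It does not vanish at \<open>Q0\<close>, so it has finitely many zeros, and
  points of the line arbitrarily close to \<open>Q\<close> avoid them.\<close>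

lemma generically_polynomial_nonzero:
  fixes p :: "'q::euclidean_space \<Rightarrow> real"
  assumes p: "real_polynomial_function p" and Q0: "p Q0 \<noteq> 0"
  shows "generically (\<lambda>Q. p Q \<noteq> 0)"
proof -
  let ?U = "p -` (- {0})"
  have "continuous_on UNIV p"
    using p continuous_on_polymonial_function real_polynomial_function_eq by blast
  then have "open ?U"
    by (intro open_vimage) auto
  moreover have "Q \<in> closure ?U" for Q
  proof (rule closure_approachable [THEN iffD2], intro allI impI)
    fix e :: real assume "e > 0"
    define l where "l t = Q + t *\<^sub>R (Q0 - Q)" for t :: real
    have "polynomial_function l"
      unfolding l_def by (intro polynomial_function_add polynomial_function_mult) auto
    then have "real_polynomial_function (p \<circ> l)"
      using p by blast
    then obtain a n where an: "p \<circ> l = (\<lambda>x. \<Sum>i\<le>n. a i * x ^ i)"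
      using real_polynomial_function_imp_sum by blast
    have "(p \<circ> l) 1 \<noteq> 0" using Q0 by (simp add: l_def)
    then have "\<exists>i\<le>n. a i \<noteq> 0"
      unfolding an by (metis (no_types, lifting) atMost_iff mult_zero_left sum.neutral)
    then have fin: "finite {x. (p \<circ> l) x = 0}"
      unfolding an polyfun_finite_roots .
    \<comment> \<open>The summand 1 covers the case \<open>Q = Q0\<close>.\<close>
    have pos: "e / (norm (Q0 - Q) + 1) > 0"
      using \<open>e > 0\<close> by (simp add: add_nonneg_pos)
    have "infinite {0<..<e / (norm (Q0 - Q) + 1)}"
      using pos by (simp add: infinite_Ioo)
    then obtain t where t: "0 < t" "t < e / (norm (Q0 - Q) + 1)" "(p \<circ> l) t \<noteq> 0"
      using finite_subset [OF _ fin] by (metis (mono_tags, lifting) greaterThanLessThan_iff mem_Collect_eq subsetI)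
    have "dist (l t) Q = t * norm (Q0 - Q)"
      using t by (simp add: l_def dist_norm)
    also have "\<dots> \<le> t * (norm (Q0 - Q) + 1)"
      using t by (simp add: mult_left_mono)
    also have "\<dots> < e"
      using t by (simp add: pos_less_divide_eq add_nonneg_pos)
    finally show "\<exists>y\<in>?U. dist y Q < e"
      using t by (intro bexI [of _ "l t"]) auto
  qed
  ultimately show ?thesis
    unfolding generically_def by (intro exI [of _ ?U]) auto
qed

lemma real_polynomial_function_det:
  fixes A :: "'q::euclidean_space \<Rightarrow> real^'m^'m"
  assumes "\<And>i j. real_polynomial_function (\<lambda>Q. A Q $ i $ j)"
  shows "real_polynomial_function (\<lambda>Q. det (A Q))"
  unfolding det_def
  by (intro real_polynomial_function_sum real_polynomial_function_prod
      real_polynomial_function.intros(2,4) assms) (auto simp: finite_permutations)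

text \<open>A left inverse of \<open>M Q0\<close> on \<open>X\<close> turns \<open>M Q\<close> into an endomorphism that is the identity
  on a complement of \<open>X\<close>; its determinant is a polynomial in \<open>Q\<close> with value 1 at \<open>Q0\<close>.\<close>

lemma generically_inj_on:
  fixes M :: "'q::euclidean_space \<Rightarrow> real^'m \<Rightarrow> 'v::euclidean_space"
  assumes lin: "\<And>Q. linear (M Q)" and poly: "\<And>x. polynomial_function (\<lambda>Q. M Q x)"
    and X: "subspace X" and Q0: "inj_on (M Q0) X"
  shows "generically (\<lambda>Q. inj_on (M Q) X)"
proof -
  obtain G where G: "linear G" "\<And>x. x \<in> X \<Longrightarrow> G (M Q0 x) = x"
    using linear_exists_left_inverse_on [OF lin X Q0] by blast
  \<comment> \<open>A left inverse of the identity on \<open>X\<close> with values in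
    \<open>X\<close> is a linear projection onto \<open>X\<close>.\<close>
  obtain pr where pr: "linear pr" "range pr \<subseteq> X" "\<And>x. x \<in> X \<Longrightarrow> pr x = x"
    using linear_exists_left_inverse_on [of id X] X linear_id by auto
  define T where "T Q x = G (M Q (pr x)) + (x - pr x)" for Q x
  have linT: "linear (T Q)" for Q
    unfolding T_def
    using linear_compose [OF linear_compose [OF pr(1) lin] G(1)] pr(1)
    by (intro linear_compose_add linear_compose_sub linear_id [unfolded id_def]) (auto simp: o_def)
  have "T Q0 = id"
    unfolding T_def using pr G by (auto simp: fun_eq_iff)
  then have one: "det (matrix (T Q0)) = 1"
    by (simp add: matrix_id_mat_1)
  have "real_polynomial_function (\<lambda>Q. matrix (T Q) $ i $ j)" for i j
  proof -
    have "bounded_linear ((\<lambda>v. v $ i) \<circ> G)"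
      using G(1) by (intro linear_conv_bounded_linear [THEN iffD1] linear_compose)
        (auto intro: linearI)
    then have "real_polynomial_function ((\<lambda>v. v $ i) \<circ> G \<circ> (\<lambda>Q. M Q (pr (axis j 1))))"
      using poly unfolding polynomial_function_def by blast
    then show ?thesis
      unfolding matrix_def T_def by (simp add: o_def) (intro real_polynomial_function.intros(2,3))
  qed
  then have "real_polynomial_function (\<lambda>Q. det (matrix (T Q)))"
    by (rule real_polynomial_function_det)
  then have "generically (\<lambda>Q. det (matrix (T Q)) \<noteq> 0)"
    using one by (intro generically_polynomial_nonzero [of _ Q0]) auto
  then show ?thesis
  proof (rule generically_mono)
    fix Q assume "det (matrix (T Q)) \<noteq> 0"
    then have inj: "inj (T Q)"
      using linT det_nz_iff_inj matrix_works by (metis (no_types, lifting) ext)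
    show "inj_on (M Q) X"
    proof (rule inj_onI)
      fix x y assume "x \<in> X" "y \<in> X" "M Q x = M Q y"
      then have "T Q x = T Q y" by (simp add: T_def pr)
      with inj show "x = y" by (simp add: inj_eq)
    qed
  qed
qed

text \<open>Both upper bounds hold for every \<open>Q\<close>. For the lower bound a subspace
  \<open>Y\<close> of the desired dimension is fixed before \<open>Q\<close> varies, and injectivity
  on this one \<open>Y\<close> suffices; hence the existence hypothesis only concerns subspaces that
  fit into the target.\<close>

lemma generically_dim_image:
  fixes M :: "'q::euclidean_space \<Rightarrow> real^'m \<Rightarrow> 'v::euclidean_space"
  assumes lin: "\<And>Q. linear (M Q)" and poly: "\<And>x. polynomial_function (\<lambda>Q. M Q x)"
    and X: "subspace X"
    and ex: "\<And>Y. subspace Y \<Longrightarrow> Y \<subseteq> X \<Longrightarrow> dim Y \<le> DIM('v) \<Longrightarrow> \<exists>Q. inj_on (M Q) Y"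
  shows "generically (\<lambda>Q. dim (M Q ` X) = min (dim X) DIM('v))"
proof -
  obtain Y where Y: "subspace Y" "Y \<subseteq> X" "dim Y = min (dim X) DIM('v)"
    using choose_subspace_of_subspace [of "min (dim X) DIM('v)" X] X
    by (metis min.cobounded1 span_eq_iff)
  then obtain Q0 where "inj_on (M Q0) Y"
    using ex [OF Y(1,2)] by auto
  then have "generically (\<lambda>Q. inj_on (M Q) Y)"
    using generically_inj_on lin poly Y by blast
  then show ?thesis
  proof (rule generically_mono)
    fix Q assume "inj_on (M Q) Y"
    then have "dim (M Q ` Y) = dim Y"
      using Y by (intro dim_image_eq lin) (simp add: span_eq_iff [THEN iffD2])
    moreover have "dim (M Q ` Y) \<le> dim (M Q ` X)"
      using Y by (intro dim_subset) auto
    moreover have "dim (M Q ` X) \<le> dim X"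
      by (rule dim_image_le [OF lin])
    moreover have "dim (M Q ` X) \<le> DIM('v)"
      by (rule dim_subset_UNIV)
    ultimately show "dim (M Q ` X) = min (dim X) DIM('v)"
      using Y by auto
  qed
qed

section \<open>Balance and potentials\<close>

text \<open>Switching by \<open>f\<close> turns all gains on \<open>S\<close> into 0. The existence
  of such an \<open>f\<close> is the form in which balance enters linear algebra.\<close>

definition potential :: "('e \<Rightarrow> 'n \<times> 'n) \<Rightarrow> ('e \<Rightarrow> real) \<Rightarrow> 'e set \<Rightarrow> ('n \<Rightarrow> real) \<Rightarrow> bool" where
  "potential ends g S f \<longleftrightarrow> (\<forall>e\<in>S. f (snd (ends e)) - f (fst (ends e)) = g e)"

lemma phi_potential:
  assumes "potential ends g S f" "e \<in> S" "ends e = (i, j) \<or> ends e = (j, i)"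
  shows "phi ends g e i j = f j - f i"
proof -
  have *: "g e = f (snd (ends e)) - f (fst (ends e))"
    using assms(1,2) by (simp add: potential_def)
  show ?thesis
    using assms(3)
  proof
    assume "ends e = (i, j)"
    then show ?thesis using * by (simp add: phi_def)
  next
    assume "ends e = (j, i)"
    then show ?thesis using * by (cases "i = j") (simp_all add: phi_def)
  qed
qed

text \<open>Gains are differences of \<open>f\<close>, and around a circle the value at each vertex
  occurs once with each sign.\<close>

lemma potential_imp_balanced:
  assumes f: "potential ends g S f"
  shows "balanced ends g S"
  unfolding balanced_def
proof (intro allI impI)
  fix vs es
  assume c: "is_circle ends S vs es"
  define k where "k = length es"
  have ends: "\<forall>m<length es. ends (es ! m) = (vs ! m, vs ! ((m + 1) mod length es)) \<or>
      ends (es ! m) = (vs ! ((m + 1) mod length es), vs ! m)"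
    using c unfolding is_circle_def by (elim conjE)
  have "2 \<le> k"
    using c unfolding is_circle_def k_def by blast
  then obtain k' where k': "k = Suc k'"
    by (cases k) auto
  have "(\<Sum>m<k. phi ends g (es ! m) (vs ! m) (vs ! ((m + 1) mod k)))
      = (\<Sum>m<k. f (vs ! ((m + 1) mod k)) - f (vs ! m))"
  proof (rule sum.cong [OF refl])
    fix m assume "m \<in> {..<k}"
    then have m: "m < length es" by (simp add: k_def)
    then have "es ! m \<in> S"
      using c unfolding is_circle_def by (meson nth_mem subsetD)
    moreover have "ends (es ! m) = (vs ! m, vs ! ((m + 1) mod k)) \<or>
        ends (es ! m) = (vs ! ((m + 1) mod k), vs ! m)"
      using ends [rule_format, OF m] by (simp only: k_def)
    ultimately show "phi ends g (es ! m) (vs ! m) (vs ! ((m + 1) mod k)) = f (vs ! ((m + 1) mod k)) - f (vs ! m)"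
      by (rule phi_potential [OF f])
  qed
  also have "\<dots> = (\<Sum>m<k. f (vs ! ((m + 1) mod k))) - (\<Sum>m<k. f (vs ! m))"
    by (rule sum_subtractf)
  also have "(\<Sum>m<k. f (vs ! ((m + 1) mod k))) = (\<Sum>m<k'. f (vs ! Suc m)) + f (vs ! 0)"
    unfolding k' sum.lessThan_Suc by simp
  also have "\<dots> = (\<Sum>m<k. f (vs ! m))"
    unfolding k' sum.lessThan_Suc_shift by (rule add.commute)
  finally show "(\<Sum>m<length es. phi ends g (es ! m) (vs ! m) (vs ! ((m + 1) mod length es))) = 0"
    by (simp add: k_def)
qed

text \<open>Only the vertices are required to be distinct; distinctness of the edges, which a circle
  demands, follows. One further edge joining the two ends closes a path to a circle.\<close>

definition is_path :: "('e \<Rightarrow> 'n \<times> 'n) \<Rightarrow> 'e set \<Rightarrow> 'n list \<Rightarrow> 'e list \<Rightarrow> bool" where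
  "is_path ends S vs es \<longleftrightarrow> length vs = Suc (length es) \<and> distinct vs \<and>
     (\<forall>m<length es. es ! m \<in> S \<and>
        (ends (es ! m) = (vs ! m, vs ! Suc m) \<or> ends (es ! m) = (vs ! Suc m, vs ! m)))"

text \<open>The path grows at its front. If the new vertex already lies on it, the path is cut off
  there instead.\<close>

lemma is_path_exists:
  assumes "(x, y) \<in> (ends ` S \<union> (ends ` S)\<inverse>)\<^sup>*"
  shows "\<exists>vs es. is_path ends S vs es \<and> hd vs = x \<and> last vs = y"
  using assms
proof (induction rule: converse_rtrancl_induct)
  case base
  show ?case
    by (intro exI [of _ "[y]"] exI [of _ "[]"]) (auto simp: is_path_def)
next
  case (step x z)
  then obtain vs es where p: "is_path ends S vs es" "hd vs = z" "last vs = y" by blast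
  obtain e where e: "e \<in> S" "ends e = (x, z) \<or> ends e = (z, x)"
    using step(1) by auto
  have len: "length vs = Suc (length es)" using p by (simp add: is_path_def)
  then have z: "vs ! 0 = z" using p(2) by (cases vs) auto
  show ?case
  proof (cases "x \<in> set vs")
    case False
    have "is_path ends S (x # vs) (e # es)"
      using p(1) e False z unfolding is_path_def by (auto simp: nth_Cons split: nat.splits)
    moreover have "last (x # vs) = y" using p len by auto
    ultimately show ?thesis by (intro exI [of _ "x # vs"] exI [of _ "e # es"]) auto
  next
    case True
    then obtain k where k: "k < length vs" "vs ! k = x" by (metis in_set_conv_nth)
    have "is_path ends S (drop k vs) (drop k es)"
      using p(1) k unfolding is_path_def by (auto simp: Suc_diff_le)
    moreover have "hd (drop k vs) = x" "last (drop k vs) = y"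
      using p k by (auto simp: hd_drop_conv_nth)
    ultimately show ?thesis by blast
  qed
qed

text \<open>Equal edges have the same pair of endpoints, and on a path without repeated vertices
  this pair determines the position.\<close>

lemma is_path_distinct_edges:
  assumes "is_path ends S vs es"
  shows "distinct es"
  unfolding distinct_conv_nth
proof (intro allI impI)
  fix m m' assume m: "m < length es" "m' < length es" "m \<noteq> m'"
  show "es ! m \<noteq> es ! m'"
  proof
    assume eq: "es ! m = es ! m'"
    have vs: "distinct vs" "length vs = Suc (length es)" using assms by (auto simp: is_path_def)
    have "{vs ! k, vs ! Suc k} = {fst (ends (es ! k)), snd (ends (es ! k))}" if "k < length es" for k
    proof -
      have "ends (es ! k) = (vs ! k, vs ! Suc k) \<or> ends (es ! k) = (vs ! Suc k, vs ! k)"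
        using assms that by (simp add: is_path_def)
      then show ?thesis by (elim disjE) auto
    qed
    then have "{vs ! m, vs ! Suc m} = {vs ! m', vs ! Suc m'}"
      using m eq by metis
    then have "m = m' \<or> (m = Suc m' \<and> Suc m = m')"
      using vs m by (auto simp: doubleton_eq_iff nth_eq_iff_index_eq)
    with m show False by auto
  qed
qed

lemma potential_path_sum:
  assumes f: "potential ends g S f" and p: "is_path ends S vs es"
  shows "(\<Sum>m<length es. phi ends g (es ! m) (vs ! m) (vs ! Suc m)) = f (last vs) - f (hd vs)"
proof -
  have len: "length vs = Suc (length es)" using p by (simp add: is_path_def)
  have "(\<Sum>m<length es. phi ends g (es ! m) (vs ! m) (vs ! Suc m))
      = (\<Sum>m<length es. f (vs ! Suc m) - f (vs ! m))"
    using p unfolding is_path_def by (intro sum.cong refl phi_potential [OF f]) auto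
  also have "\<dots> = f (vs ! length es) - f (vs ! 0)"
    by (rule sum_lessThan_telescope)
  also have "\<dots> = f (last vs) - f (hd vs)"
    using len by (cases "vs = []") (simp_all add: hd_conv_nth last_conv_nth)
  finally show ?thesis .
qed

text \<open>A new edge either joins two components, and the potential is shifted on one of them,
  or closes a circle, whose vanishing gain sum makes the old potential work.\<close>

lemma balanced_imp_potential:
  assumes "finite S" "\<forall>e\<in>S. fst (ends e) \<noteq> snd (ends e)" "balanced ends g S"
  shows "\<exists>f. potential ends g S f"
  using assms
proof (induction S rule: finite_induct)
  case empty
  then show ?case by (simp add: potential_def)
next
  case (insert e S)
  have "is_circle ends S vs es \<Longrightarrow> is_circle ends (insert e S) vs es" for vs es
    by (auto simp: is_circle_def)
  then have "balanced ends g S"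
    using insert.prems(2) by (auto simp: balanced_def)
  then obtain f where f: "potential ends g S f"
    using insert by auto
  obtain i j where e: "ends e = (i, j)" by fastforce
  then have ij: "i \<noteq> j" using insert.prems(1) by auto
  let ?R = "(ends ` S \<union> (ends ` S)\<inverse>)\<^sup>*"
  show ?case
  proof (cases "(j, i) \<in> ?R")
    case True
    then obtain vs es where p: "is_path ends S vs es" "hd vs = j" "last vs = i"
      using is_path_exists [OF True] by blast
    let ?es = "es @ [e]" and ?k = "length es"
    have len: "length vs = Suc ?k" and vs: "distinct vs" using p by (auto simp: is_path_def)
    then have "vs \<noteq> []" by auto
    then have hl: "vs ! 0 = j" "vs ! ?k = i"
      using p(2,3) len by (simp_all add: hd_conv_nth last_conv_nth)
    \<comment> \<open>Together with \<open>e\<close> the circle has length at least 2; length 2 is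
      the case of a parallel edge.\<close>
    then have pos: "Suc 0 \<le> ?k" using ij by (cases es) auto
    have sub: "set es \<subseteq> S" using p by (auto simp: is_path_def in_set_conv_nth)
    have "is_circle ends (insert e S) vs ?es"
      unfolding is_circle_def
    proof (intro conjI allI impI)
      show "distinct ?es"
        using is_path_distinct_edges [OF p(1)] sub insert.hyps by auto
      fix m assume "m < length ?es"
      then consider "m < ?k" | "m = ?k" by fastforce
      then show "ends (?es ! m) = (vs ! m, vs ! ((m + 1) mod length ?es)) \<or>
          ends (?es ! m) = (vs ! ((m + 1) mod length ?es), vs ! m)"
        using p(1) hl e by cases (auto simp: is_path_def nth_append)
    qed (use len vs pos sub in auto)
    then have "(\<Sum>m<length ?es. phi ends g (?es ! m) (vs ! m) (vs ! ((m + 1) mod length ?es))) = 0"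
      using insert.prems(2) unfolding balanced_def by blast
    \<comment> \<open>The path runs from \<open>j\<close> to \<open>i\<close>, and \<open>e\<close>
      leads back from \<open>i\<close> to \<open>j\<close>.\<close>
    then have "(\<Sum>m<?k. phi ends g (es ! m) (vs ! m) (vs ! Suc m)) + phi ends g e i j = 0"
      using hl by (simp add: nth_append)
    then have "f i - f j + g e = 0"
      unfolding potential_path_sum [OF f p(1)] using p e by (simp add: phi_def)
    then have "potential ends g (insert e S) f"
      using f e by (auto simp: potential_def)
    then show ?thesis by blast
  next
    case False
    \<comment> \<open>The shift on the component of \<open>j\<close> is chosen to give
      \<open>f' j = f i + g e\<close>; \<open>i\<close> lies outside this component and keeps its
      value.\<close>
    define f' where "f' v = f v + (if (j, v) \<in> ?R then f i + g e - f j else 0)" for v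
    have "(j, fst (ends a)) \<in> ?R \<longleftrightarrow> (j, snd (ends a)) \<in> ?R" if "a \<in> S" for a
    proof -
      have "(fst (ends a), snd (ends a)) \<in> ends ` S \<union> (ends ` S)\<inverse>"
        "(snd (ends a), fst (ends a)) \<in> ends ` S \<union> (ends ` S)\<inverse>"
        using that by auto
      then show ?thesis by (blast intro: rtrancl.rtrancl_into_rtrancl)
    qed
    then have "potential ends g S f'"
      using f unfolding potential_def f'_def by auto
    moreover have "f' j - f' i = g e"
      using False by (simp add: f'_def)
    ultimately have "potential ends g (insert e S) f'"
      using e by (simp add: potential_def)
    then show ?thesis by blast
  qed
qed

section \<open>A vector representation of the complete lift matroid\<close>

lemma dim_add_dim_orthogonal:
  fixes S :: "'a::euclidean_space set"
  shows "dim S + dim {y. \<forall>x\<in>S. x \<bullet> y = 0} = DIM('a)"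
proof -
  have "{y. \<forall>x\<in>S. x \<bullet> y = 0} = {y \<in> UNIV. \<forall>x\<in>span S. orthogonal x y}"
  proof (intro set_eqI iffI)
    fix y assume "y \<in> {y. \<forall>x\<in>S. x \<bullet> y = 0}"
    then have "orthogonal y x" if "x \<in> span S" for x
      using that by (intro orthogonal_to_span [of x S]) (auto simp: orthogonal_def inner_commute)
    then show "y \<in> {y \<in> UNIV. \<forall>x\<in>span S. orthogonal x y}"
      by (auto simp: orthogonal_commute)
  qed (auto simp: orthogonal_def span_base)
  then show ?thesis
    using dim_subspace_orthogonal_to_vectors [of "span S" UNIV] by (simp add: add.commute)
qed

text \<open>The indicator vectors of the components are an orthogonal basis. From here on, component
  counts are handled as dimensions.\<close>

lemma dim_constant_on_components:
  fixes A :: "('n::finite \<times> 'n) set"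
  shows "dim {f :: real^'n. \<forall>(i, j)\<in>A. f $ i = f $ j} = ncomp A" (is "dim ?V = _")
proof -
  let ?R = "(A \<union> A\<inverse>)\<^sup>*"
  have eq: "equiv UNIV ?R"
    by (intro equivI refl_rtrancl sym_rtrancl trans_rtrancl) (auto simp: sym_def)
  define ind :: "'n set \<Rightarrow> real^'n" where "ind C = (\<chi> i. if i \<in> C then 1 else 0)" for C
  have const: "f $ i = f $ j" if "f \<in> ?V" "(i, j) \<in> ?R" for f :: "real^'n" and i j
    using that(2) by (induction rule: rtrancl_induct) (use that(1) in auto)
  show ?thesis
  proof (rule dim_unique)
    show "ind ` (UNIV // ?R) \<subseteq> ?V"
    proof safe
      fix C i j assume C: "C \<in> UNIV // ?R" and "(i, j) \<in> A"
      then have "(i, j) \<in> ?R" "(j, i) \<in> ?R" by auto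
      then have "i \<in> C \<longleftrightarrow> j \<in> C"
        using in_quotient_imp_closed [OF eq C] by blast
      then show "ind C $ i = ind C $ j" by (simp add: ind_def)
    qed
    show "?V \<subseteq> span (ind ` (UNIV // ?R))"
    proof
      fix f assume f: "f \<in> ?V"
      have "f = (\<Sum>C\<in>UNIV // ?R. f $ (SOME i. i \<in> C) *\<^sub>R ind C)"
      proof (rule vec_eq_iff [THEN iffD2], rule allI)
        fix i
        let ?C = "?R `` {i}"
        have C: "?C \<in> UNIV // ?R" by (rule quotientI) simp
        have "(\<Sum>C\<in>UNIV // ?R. f $ (SOME i. i \<in> C) * (if i \<in> C then 1 else 0))
            = (\<Sum>C\<in>UNIV // ?R. if C = ?C then f $ (SOME i. i \<in> ?C) else 0)"
        proof (rule sum.cong [OF refl])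
          fix C assume "C \<in> UNIV // ?R"
          then have "i \<in> C \<longleftrightarrow> C = ?C"
            using quotient_eq_iff [OF eq _ C, of C i i] equiv_class_self [OF eq, of i] by auto
          then show "f $ (SOME i. i \<in> C) * (if i \<in> C then 1 else 0)
              = (if C = ?C then f $ (SOME i. i \<in> ?C) else 0)" by auto
        qed
        also have "\<dots> = f $ (SOME i. i \<in> ?C)"
          using C by (simp add: finite_quotient)
        also have "\<dots> = f $ i"
        proof -
          have "(i, SOME k. k \<in> ?C) \<in> ?R"
            using someI [of "\<lambda>k. k \<in> ?C" i] by auto
          then show ?thesis using const [OF f] by simp
        qed
        finally show "f $ i = (\<Sum>C\<in>UNIV // ?R. f $ (SOME i. i \<in> C) *\<^sub>R ind C) $ i"
          by (simp add: ind_def)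
      qed
      also have "\<dots> \<in> span (ind ` (UNIV // ?R))"
        by (intro span_sum span_scale span_base imageI)
      finally show "f \<in> span (ind ` (UNIV // ?R))" .
    qed
    show "independent (ind ` (UNIV // ?R))"
    proof (rule pairwise_orthogonal_independent)
      show "pairwise orthogonal (ind ` (UNIV // ?R))"
      proof (rule pairwiseI, clarify)
        fix C D assume "C \<in> UNIV // ?R" "D \<in> UNIV // ?R" "ind C \<noteq> ind D"
        then have "C \<inter> D = {}"
          using quotient_disj [OF eq] by blast
        then show "orthogonal (ind C) (ind D)"
          by (auto simp: orthogonal_def inner_vec_def ind_def intro!: sum.neutral)
      qed
      show "0 \<notin> ind ` (UNIV // ?R)"
      proof
        assume "0 \<in> ind ` (UNIV // ?R)"
        then obtain C where C: "C \<in> UNIV // ?R" "ind C = 0" by force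
        then obtain i where "i \<in> C"
          using in_quotient_imp_non_empty [OF eq] by blast
        then have "ind C $ i = 1" by (simp add: ind_def)
        with C show False by simp
      qed
    qed
    have "inj_on ind (UNIV // ?R)"
      by (rule inj_onI) (auto simp: ind_def vec_eq_iff split: if_splits)
    then show "card (ind ` (UNIV // ?R)) = ncomp A"
      by (simp add: card_image ncomp_def)
  qed
qed

text \<open>Guards the truncated subtraction of natural numbers in \<open>lift_rank\<close>.\<close>

lemma ncomp_le: "ncomp (A :: ('n::finite \<times> 'n) set) \<le> CARD('n)"
  using dim_subset_UNIV [of "{f :: real^'n. \<forall>(i, j)\<in>A. f $ i = f $ j}"]
  by (simp add: dim_constant_on_components)

text \<open>A vector is orthogonal to all edge vectors exactly when it is constant on
  components.\<close>

lemma dim_edge_vectors: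
  fixes A :: "('n::finite \<times> 'n) set"
  shows "dim ((\<lambda>(i, j). axis j 1 - axis i 1 :: real^'n) ` A) = CARD('n) - ncomp A"
proof -
  have "{y :: real^'n. \<forall>x\<in>(\<lambda>(i, j). axis j 1 - axis i 1) ` A. x \<bullet> y = 0}
      = {f. \<forall>(i, j)\<in>A. f $ i = f $ j}"
    by (auto simp: inner_diff_left inner_axis' split: prod.splits)
  then show ?thesis
    using dim_add_dim_orthogonal [of "(\<lambda>(i, j). axis j 1 - axis i 1 :: real^'n) ` A"]
    by (simp add: dim_constant_on_components)
qed

text \<open>The sign of \<open>g e\<close> is such that a vector with \<open>None\<close>-coordinate
  1 is orthogonal to the vector of \<open>e\<close> exactly when its vertex coordinates satisfy the
  potential equation of \<open>e\<close>.\<close>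

definition lift_vec :: "('e \<Rightarrow> 'n::finite \<times> 'n) \<Rightarrow> ('e \<Rightarrow> real) \<Rightarrow> 'e option \<Rightarrow> real^('n option)" where
  "lift_vec ends g x = (case x of None \<Rightarrow> axis None 1
     | Some e \<Rightarrow> axis (Some (snd (ends e))) 1 - axis (Some (fst (ends e))) 1 - g e *\<^sub>R axis None 1)"

lemma inner_lift_vec:
  "lift_vec ends g None \<bullet> w = w $ None"
  "lift_vec ends g (Some e) \<bullet> w = w $ Some (snd (ends e)) - w $ Some (fst (ends e)) - g e * w $ None"
  by (simp_all add: lift_vec_def inner_diff_left inner_axis')

text \<open>The orthogonal complement of the vectors consists of the scaled potentials.\<close>

lemma dim_lift_vec:
  fixes ends :: "'e \<Rightarrow> 'n::finite \<times> 'n"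
  assumes fin: "finite S" and ne: "\<forall>e. Some e \<in> S \<longrightarrow> fst (ends e) \<noteq> snd (ends e)"
  shows "dim (lift_vec ends g ` S) = lift_rank ends g S"
proof -
  let ?S = "{e. Some e \<in> S}"
  let ?c = "ncomp (ends ` ?S)"
  \<comment> \<open>\<open>K0\<close> is the part of the orthogonal complement \<open>K\<close> with
    \<open>None\<close>-coordinate 0. Its dimension is the number of components whatever the gains
    are, and \<open>K\<close> is one dimension larger exactly when \<open>None\<close> is not in
    \<open>S\<close> and a potential exists.\<close>
  define K where "K = {w. \<forall>x\<in>lift_vec ends g ` S. x \<bullet> w = 0}"
  define K0 :: "(real^'n option) set" where
    "K0 = {w. w $ None = 0 \<and> (\<forall>e\<in>?S. w $ Some (fst (ends e)) = w $ Some (snd (ends e)))}"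
  have K: "w \<in> K \<longleftrightarrow> (None \<in> S \<longrightarrow> w $ None = 0) \<and>
      (\<forall>e\<in>?S. w $ Some (snd (ends e)) - w $ Some (fst (ends e)) = g e * w $ None)" for w
  proof -
    have "w \<in> K \<longleftrightarrow> (None \<in> S \<longrightarrow> lift_vec ends g None \<bullet> w = 0) \<and>
        (\<forall>e\<in>?S. lift_vec ends g (Some e) \<bullet> w = 0)"
    proof -
      have "w \<in> K \<longleftrightarrow> (\<forall>x. x \<in> S \<longrightarrow> lift_vec ends g x \<bullet> w = 0)"
        unfolding K_def by blast
      then show ?thesis by (simp only: split_option_all mem_Collect_eq Ball_def)
    qed
    then show ?thesis by (simp add: inner_lift_vec)
  qed
  have "subspace K0" "subspace K"
    unfolding K0_def K_def by (auto simp: subspace_def inner_add_right)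
  have sub: "K0 \<subseteq> K" by (auto simp: K K0_def)
  have card: "CARD('n option) = Suc (CARD('n))"
    by (simp add: card_UNIV_option)
  have dimK: "dim (lift_vec ends g ` S) + dim K = Suc (CARD('n))"
    using dim_add_dim_orthogonal [of "lift_vec ends g ` S"] by (simp add: K_def card)
  define h :: "real^'n \<Rightarrow> real^('n option)" where
    "h f = (\<chi> k. case k of None \<Rightarrow> 0 | Some i \<Rightarrow> f $ i)" for f
  have h: "linear h"
    by (rule linearI) (auto simp: h_def vec_eq_iff split: option.splits)
  have "inj h"
    by (rule injI) (auto simp: h_def vec_eq_iff split_option_all)
  have "K0 = h ` {f. \<forall>(i, j)\<in>ends ` ?S. f $ i = f $ j}"
  proof safe
    fix w assume w: "w \<in> K0"
    have "w = h (\<chi> i. w $ Some i)"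
      using w by (auto simp: vec_eq_iff h_def K0_def split: option.splits)
    moreover have "(\<chi> i. w $ Some i) \<in> {f. \<forall>(i, j)\<in>ends ` ?S. f $ i = f $ j}"
      using w unfolding K0_def by (auto simp: case_prod_unfold)
    ultimately show "w \<in> h ` {f. \<forall>(i, j)\<in>ends ` ?S. f $ i = f $ j}" by (rule image_eqI)
  qed (auto simp: K0_def h_def split: prod.splits)
  then have dimK0: "dim K0 = ?c"
    by (simp only: dim_image_eq [OF h inj_on_subset [OF \<open>inj h\<close> subset_UNIV]] dim_constant_on_components)
  show ?thesis
  proof (cases "None \<notin> S \<and> balanced ends g ?S")
    case True
    have "finite ?S"
      using finite_vimageI [OF fin, of Some] by (simp add: vimage_def)
    then obtain f where f: "potential ends g ?S f"
      using balanced_imp_potential [of ?S ends g] ne True by auto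
    define w0 :: "real^('n option)" where "w0 = (\<chi> k. case k of None \<Rightarrow> 1 | Some i \<Rightarrow> f i)"
    have w0: "w0 \<in> K" "w0 $ None = 1"
      using True f by (auto simp: K w0_def potential_def)
    have "span (insert w0 K0) = K"
    proof
      show "span (insert w0 K0) \<subseteq> K"
        using w0 sub \<open>subspace K\<close> by (intro span_minimal) auto
      show "K \<subseteq> span (insert w0 K0)"
      proof
        fix w assume w: "w \<in> K"
        have "w - w $ None *\<^sub>R w0 \<in> K"
          using w w0 \<open>subspace K\<close> by (simp add: subspace_diff subspace_scale)
        then have "w - w $ None *\<^sub>R w0 \<in> K0"
          using w0 by (auto simp: K K0_def algebra_simps)
        then show "w \<in> span (insert w0 K0)"
          by (metis span_breakdown_eq span_base)
      qed
    qed
    moreover have "w0 \<notin> span K0"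
      using w0 \<open>subspace K0\<close> by (metis (mono_tags, lifting) K0_def mem_Collect_eq span_eq_iff zero_neq_one)
    ultimately have "dim K = Suc ?c"
      by (metis Suc_eq_plus1 dim_insert dim_span dimK0)
    then show ?thesis
      using True dimK by (simp add: lift_rank_def)
  next
    case False
    have "K \<subseteq> K0"
    proof
      fix w assume w: "w \<in> K"
      have "w $ None = 0"
      proof (rule ccontr)
        assume "w $ None \<noteq> 0"
        \<comment> \<open>Dividing by the non-zero \<open>None\<close>-coordinate normalizes it to
          1.\<close>
        then have "potential ends g ?S (\<lambda>i. w $ Some i / w $ None)"
          using w unfolding K potential_def by (metis (no_types, lifting) diff_divide_distrib nonzero_mult_div_cancel_right)
        then show False
          using False w \<open>w $ None \<noteq> 0\<close> potential_imp_balanced unfolding K by blast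
      qed
      then show "w \<in> K0" using w by (auto simp: K K0_def)
    qed
    then have "K = K0" using sub by auto
    moreover have "?c \<le> CARD('n)"
      by (rule ncomp_le)
    ultimately show ?thesis
      using False dimK dimK0 by (auto simp: lift_rank_def)
  qed
qed

section \<open>Generic rank of the normal vectors\<close>

definition lcomb :: "real^'d^'n \<Rightarrow> real^'n \<Rightarrow> real^'d" where
  "lcomb Q a = (\<Sum>i\<in>UNIV. a $ i *\<^sub>R Q $ i)"

lemma linear_lcomb: "linear (lcomb Q)"
  by (rule linearI)
    (simp_all add: lcomb_def algebra_simps sum.distrib scaleR_sum_right)

text \<open>Every linear map \<open>q\<close> arises as \<open>lcomb Q\<close>, so choosing points
  amounts to choosing a linear map freely.\<close>

lemma lcomb_linear_images:
  assumes "linear q"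
  shows "lcomb (\<chi> i. q (axis i 1)) a = q a"
proof -
  have "q a = q (\<Sum>i\<in>UNIV. a $ i *\<^sub>R axis i 1)"
    using basis_expansion [of a] by (simp add: scalar_mult_eq_scaleR)
  also have "\<dots> = lcomb (\<chi> i. q (axis i 1)) a"
    by (simp add: linear_sum [OF assms] linear_scale [OF assms] lcomb_def)
  finally show ?thesis by simp
qed

text \<open>Preserving norms gives injectivity on \<open>Y\<close> together with a quantitative
  bound that survives a perturbation of explicit size.\<close>

lemma ex_linear_isometry_on:
  fixes Y :: "(real^'n) set"
  assumes "subspace Y" "dim Y \<le> CARD('d)"
  shows "\<exists>q :: real^'n \<Rightarrow> real^'d. linear q \<and> (\<forall>y\<in>Y. norm (q y) = norm y)"
proof -
  have "dim Y \<le> dim (UNIV :: (real^'d) set)"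
    using assms(2) by simp
  then obtain q :: "real^'n \<Rightarrow> real^'d" where "linear q" "\<And>y. y \<in> Y \<Longrightarrow> norm (q y) = norm y"
    by (rule isometry_subset_subspace [OF assms(1) subspace_UNIV]) auto
  then show ?thesis by auto
qed

lemma sum_zero_second_support:
  fixes x :: "real^'n"
  assumes "(\<Sum>i\<in>UNIV. x $ i) = 0" "x $ i \<noteq> 0"
  shows "\<exists>j. j \<noteq> i \<and> x $ j \<noteq> 0"
proof (rule ccontr)
  assume "\<not> ?thesis"
  then have "(\<Sum>j\<in>UNIV - {i}. x $ j) = 0"
    by (intro sum.neutral) auto
  then show False
    using assms by (simp add: sum.remove [of UNIV i])
qed

text \<open>A non-zero \<open>x\<close> in \<open>X\<close> has two non-zero entries
  \<open>i\<close> and \<open>j\<close>. Eliminating entry \<open>i\<close> from a vector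
  independent of \<open>x\<close> leaves a non-zero \<open>z\<close>, again with two non-zero
  entries, one of them at some \<open>k\<close> other than \<open>j\<close>. Then \<open>x\<close>
  or a combination of \<open>x\<close> and \<open>z\<close> is non-zero at all three places.\<close>

lemma ex_support_ge_three:
  fixes X :: "(real^'n) set"
  assumes X: "subspace X" "dim X \<ge> 2" and sum0: "\<And>x. x \<in> X \<Longrightarrow> (\<Sum>i\<in>UNIV. x $ i) = 0"
  shows "\<exists>a\<in>X. \<exists>i j k. i \<noteq> j \<and> j \<noteq> k \<and> i \<noteq> k \<and> a $ i \<noteq> 0 \<and> a $ j \<noteq> 0 \<and> a $ k \<noteq> 0"
proof -
  have "\<not> X \<subseteq> {0}"
    using X(2) by (metis dim_eq_0 not_numeral_le_zero)
  then obtain x where x: "x \<in> X" "x \<noteq> 0" by auto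
  then obtain i where i: "x $ i \<noteq> 0" by (metis vec_eq_iff zero_index)
  then obtain j where j: "j \<noteq> i" "x $ j \<noteq> 0"
    using sum_zero_second_support sum0 x by blast
  have "\<not> X \<subseteq> span {x}"
  proof
    assume "X \<subseteq> span {x}"
    then have "dim X \<le> card {x}" by (rule dim_le_card) simp
    with X(2) show False by simp
  qed
  then obtain y where y: "y \<in> X" "y \<notin> span {x}" by auto
  define z where "z = y - (y $ i / x $ i) *\<^sub>R x"
  have z: "z \<in> X" "z $ i = 0"
    using x y X i by (auto simp: z_def subspace_diff subspace_scale)
  have "z \<noteq> 0"
  proof
    assume "z = 0"
    then have "y = (y $ i / x $ i) *\<^sub>R x" by (simp add: z_def)
    then show False using y(2) by (metis span_base span_scale singletonI)
  qed
  then obtain k0 where k0: "z $ k0 \<noteq> 0" by (metis vec_eq_iff zero_index)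
  then obtain k1 where k1: "k1 \<noteq> k0" "z $ k1 \<noteq> 0"
    using sum_zero_second_support sum0 z by blast
  then obtain k where k: "k \<noteq> j" "z $ k \<noteq> 0"
    using k0 by metis
  then have "k \<noteq> i" using z by auto
  \<comment> \<open>If \<open>c = 1\<close> cancels the entry at \<open>j\<close>, then
    \<open>c = 2\<close> turns it into \<open>- x $ j\<close>, which is non-zero.\<close>
  define c :: real where "c = (if x $ j + z $ j = 0 then 2 else 1)"
  define w where "w = x + c *\<^sub>R z"
  have c: "c \<noteq> 0" "x $ j + c * z $ j \<noteq> 0" using j by (auto simp: c_def)
  show ?thesis
  proof (cases "x $ k = 0")
    case False
    then show ?thesis
      using x(1) i j k(1) \<open>k \<noteq> i\<close> by (intro bexI [of _ x] exI [of _ i] exI [of _ j] exI [of _ k]) auto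
  next
    case True
    have "w \<in> X" using x z X by (simp add: w_def subspace_add subspace_scale)
    moreover have "w $ i \<noteq> 0" "w $ j \<noteq> 0" "w $ k \<noteq> 0"
      using i z c k True by (simp_all add: w_def)
    ultimately show ?thesis
      using j(1) k(1) \<open>k \<noteq> i\<close> by (intro bexI [of _ w] exI [of _ i] exI [of _ j] exI [of _ k]) auto
  qed
qed

text \<open>Of three non-zero numbers some two have a non-zero sum. For such a pair,
  \<open>p\<close> with entries \<open>a $ j\<close> and \<open>- a $ i\<close> is orthogonal to
  \<open>a\<close> and has the quadratic value \<open>a $ i * a $ j * (a $ i + a $ j)\<close>. For
  \<open>a\<close> with only the entries 1 and -1 the statement fails: \<open>p\<close> then agrees
  at both places.\<close>

lemma ex_orthogonal_quadratic_nonzero: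
  fixes a :: "real^'n"
  assumes "i \<noteq> j" "j \<noteq> k" "i \<noteq> k" "a $ i \<noteq> 0" "a $ j \<noteq> 0" "a $ k \<noteq> 0"
  shows "\<exists>p :: real^'n. p \<bullet> a = 0 \<and> (\<Sum>l\<in>UNIV. a $ l * (p $ l)\<^sup>2) \<noteq> 0"
proof -
  have step: ?thesis if "i \<noteq> j" "a $ i \<noteq> 0" "a $ j \<noteq> 0" "a $ i + a $ j \<noteq> 0" for i j
  proof -
    define p :: "real^'n" where "p = (\<chi> l. if l = i then a $ j else if l = j then - a $ i else 0)"
    have "p \<bullet> a = (\<Sum>l\<in>{i, j}. p $ l * a $ l)"
      unfolding inner_vec_def by (intro sum.mono_neutral_cong_right) (auto simp: p_def)
    then have "p \<bullet> a = 0"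
      using that by (simp add: p_def)
    moreover have "(\<Sum>l\<in>UNIV. a $ l * (p $ l)\<^sup>2) = (\<Sum>l\<in>{i, j}. a $ l * (p $ l)\<^sup>2)"
      by (intro sum.mono_neutral_cong_right) (auto simp: p_def)
    then have "(\<Sum>l\<in>UNIV. a $ l * (p $ l)\<^sup>2) = a $ i * a $ j * (a $ i + a $ j)"
      using that by (simp add: p_def power2_eq_square algebra_simps)
    ultimately show ?thesis using that by (intro exI [of _ p]) auto
  qed
  show ?thesis
  proof (cases "a $ i + a $ j = 0 \<and> a $ j + a $ k = 0")
    case True
    then have "a $ i + a $ k \<noteq> 0" using assms by auto
    then show ?thesis using step assms by blast
  next
    case False
    then show ?thesis using step assms by blast
  qed
qed

text \<open>In the equation of \<open>h(e)\<close> the term \<open>(norm P)\<^sup>2\<close> cancels.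
  With ends \<open>(i, j)\<close> there remains the affine form with linear part
  \<open>2 (Q_j - Q_i)\<close> and constant
  \<open>(norm Q_i)\<^sup>2 - (norm Q_j)\<^sup>2 - g e\<close>, which is the image of the vector of
  \<open>e\<close>.\<close>

definition lift_map :: "real^'d^'n \<Rightarrow> real^(('n::finite) option) \<Rightarrow> (real^'d) \<times> real" where
  "lift_map Q w = (2 *\<^sub>R lcomb Q (\<chi> i. w $ Some i),
     w $ None - (\<Sum>i\<in>UNIV. w $ Some i * (norm (Q $ i))\<^sup>2))"

lemma linear_lift_map: "linear (lift_map (Q :: real^'d^'n::finite))"
proof (rule linearI)
  fix v w :: "real^('n option)" and c :: real
  have "(\<chi> i. (v + w) $ Some i) = (\<chi> i. v $ Some i) + (\<chi> i. w $ Some i)"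
    "(\<chi> i. (c *\<^sub>R v) $ Some i) = c *\<^sub>R (\<chi> i. v $ Some i)"
    by (simp_all add: vec_eq_iff)
  then show "lift_map Q (v + w) = lift_map Q v + lift_map Q w" "lift_map Q (c *\<^sub>R v) = c *\<^sub>R lift_map Q v"
    by (simp_all add: lift_map_def linear_add [OF linear_lcomb] linear_scale [OF linear_lcomb]
        algebra_simps sum.distrib sum_distrib_left)
qed

lemma linear_vertex_part: "linear (\<lambda>w :: real^(('n::finite) option). (\<chi> i. w $ Some i) :: real^'n)"
  by (rule linearI) (simp_all add: vec_eq_iff)

lemma vec_option_eqI:
  fixes v w :: "real^(('n::finite) option)"
  assumes "(\<chi> i. v $ Some i :: real^'n) = (\<chi> i. w $ Some i)" "v $ None = w $ None"
  shows "v = w"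
  using assms by (simp add: vec_eq_iff split_option_all)

lemma inj_on_linear_dim_le:
  fixes f :: "'a::euclidean_space \<Rightarrow> 'b::euclidean_space"
  assumes f: "linear f" and X: "subspace X" and le: "dim X \<le> dim (f ` X)"
  shows "inj_on f X"
proof -
  obtain B where B: "B \<subseteq> X" "independent B" "X \<subseteq> span B" "card B = dim X"
    using basis_exists by blast
  have fin: "finite B" using B by (simp add: independent_bound_general)
  have X_eq: "X = span B" using B X by (metis span_minimal subset_antisym)
  have img: "f ` X = span (f ` B)" using X_eq f by (simp add: linear_span_image)
  have "dim (f ` X) \<le> card (f ` B)"
    unfolding img dim_span using fin by (intro dim_le_card span_superset) auto
  moreover have "card (f ` B) \<le> card B" using fin by (rule card_image_le)
  ultimately have card: "card (f ` B) = card B" "card (f ` B) \<le> dim (f ` X)" using le B by linarith+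
  have "independent (f ` B)"
    using card(2) fin img by (intro card_le_dim_spanning [of _ "f ` X"]) (auto simp: span_base)
  moreover have "inj_on f B" using card fin by (simp add: eq_card_imp_inj_on)
  ultimately show ?thesis
    unfolding X_eq by (simp add: linear_inj_on_span_iff_independent_image [OF f])
qed

text \<open>If the first components of \<open>X\<close> have dimension \<open>d + 1\<close>, the points can be chosen with a linear
  dependency \<open>a\<close>; the quadratic entry of \<open>lift_map\<close> must then separate \<open>a\<close>,
  which is arranged by moving the points \<open>Q $ i\<close> by \<open>s * p $ i\<close> in a fixed direction.\<close>

lemma ex_inj_on_lift_map:
  fixes X :: "(real^(('n::finite) option)) set"
  assumes X: "subspace X" and sum0: "\<And>w. w \<in> X \<Longrightarrow> (\<Sum>i\<in>UNIV. w $ Some i) = 0"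
    and dim: "dim X \<le> CARD('d) + 1"
  shows "\<exists>Q :: real^'d^'n. inj_on (lift_map Q) X"
proof -
  define pr where "pr w = (\<chi> i. w $ Some i)" for w :: "real^(('n::finite) option)"
  have pr: "linear pr" using linear_vertex_part by (simp add: pr_def [abs_def])
  have X': "subspace (pr ` X)" using pr X by (rule linear_subspace_image)
  have inj: "inj_on (lift_map Q) X" if "\<And>w. w \<in> X \<Longrightarrow> lift_map Q w = 0 \<Longrightarrow> w = 0" for Q :: "real^'d^'n"
    using that linear_inj_on_iff_eq_0 [OF linear_lift_map X] by blast
  show ?thesis
  proof (cases "dim (pr ` X) \<le> CARD('d)")
    case True
    then obtain q :: "real^'n \<Rightarrow> real^'d" where q: "linear q" "\<And>y. y \<in> pr ` X \<Longrightarrow> norm (q y) = norm y"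
      using ex_linear_isometry_on X' by blast
    have "w = 0" if "w \<in> X" "lift_map (\<chi> i. q (axis i 1)) w = 0" for w
    proof (rule vec_option_eqI)
      have "q (pr w) = 0"
        using that(2) by (simp add: lift_map_def lcomb_linear_images [OF q(1)] pr_def prod_eq_iff)
      then have "pr w = 0"
        using q(2) [of "pr w"] that(1) by simp
      then have 0: "w $ Some i = 0" for i by (simp add: pr_def vec_eq_iff)
      then show "(\<chi> i. w $ Some i) = (\<chi> i. 0 $ Some i)" by simp
      \<comment> \<open>Once the vertex part vanishes, the last entry of the image is
        \<open>w $ None\<close> itself.\<close>
      show "w $ None = 0 $ None" using that(2) by (simp add: lift_map_def prod_eq_iff 0)
    qed
    then show ?thesis using inj by blast
  next
    case False
    have "dim (pr ` X) \<le> dim X" by (rule dim_image_le [OF pr])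
    with False dim have dim': "dim (pr ` X) = CARD('d) + 1" "dim X \<le> dim (pr ` X)" by auto
    \<comment> \<open>The dimensions leave no room for a kernel, so an element of \<open>X\<close>
      is determined by its vertex part.\<close>
    have pr_inj: "inj_on pr X" using inj_on_linear_dim_le [OF pr X dim'(2)] .
    have "dim (pr ` X) \<ge> 2" using dim' by simp
    moreover have "(\<Sum>i\<in>UNIV. x $ i) = 0" if "x \<in> pr ` X" for x
      using that sum0 by (auto simp: pr_def)
    ultimately obtain a i j k where a: "a \<in> pr ` X" and
      ijk: "i \<noteq> j" "j \<noteq> k" "i \<noteq> k" "a $ i \<noteq> 0" "a $ j \<noteq> 0" "a $ k \<noteq> 0"
      using ex_support_ge_three [OF X'] by blast
    then obtain p where p: "p \<bullet> a = 0" "(\<Sum>l\<in>UNIV. a $ l * (p $ l)\<^sup>2) \<noteq> 0"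
      using ex_orthogonal_quadratic_nonzero by blast
    obtain w0 where w0: "w0 \<in> X" "pr w0 = a" using a by blast
    have "a \<noteq> 0" using ijk(4) by auto
    define Y where "Y = {y \<in> pr ` X. \<forall>x\<in>span {a}. orthogonal x y}"
    have "dim Y + dim (span {a}) = dim (pr ` X)"
      unfolding Y_def using a X' by (intro dim_subspace_orthogonal_to_vectors subspace_span span_minimal) simp_all
    then have "dim Y \<le> CARD('d)"
      using dim' \<open>a \<noteq> 0\<close> by (simp add: dim_insert)
    moreover have "subspace Y"
      using X' unfolding Y_def subspace_def by (auto simp: orthogonal_def inner_add_right)
    ultimately obtain q :: "real^'n \<Rightarrow> real^'d" where q: "linear q" "\<And>y. y \<in> Y \<Longrightarrow> norm (q y) = norm y"
      using ex_linear_isometry_on by blast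
    define proj where "proj x = x - ((x \<bullet> a) / (a \<bullet> a)) *\<^sub>R a" for x
    have proj: "linear proj"
      by (rule linearI) (simp_all add: proj_def inner_add_left add_divide_distrib algebra_simps)
    have proj_Y: "proj x \<in> Y" if "x \<in> pr ` X" for x
    proof -
      have "proj x \<in> pr ` X" using that a X' by (simp add: proj_def subspace_diff subspace_scale)
      moreover have "proj x \<bullet> a = 0" using \<open>a \<noteq> 0\<close> by (simp add: proj_def inner_diff_left)
      ultimately show ?thesis
        unfolding Y_def by (auto simp: span_singleton orthogonal_def inner_commute)
    qed
    obtain u :: "real^'d" where u: "norm u = 1" using vector_choose_size [of 1] by auto
    \<comment> \<open>Since \<open>proj a = 0\<close> and \<open>p \<bullet> a = 0\<close>, every
      \<open>r s\<close> annihilates \<open>a\<close>: the points keep this relation while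
      \<open>s\<close> moves them.\<close>
    define r where "r s x = q (proj x) + (s * (p \<bullet> x)) *\<^sub>R u" for s x
    have r: "linear (r s)" for s
      by (rule linearI) (simp_all add: r_def linear_add [OF proj] linear_scale [OF proj]
          linear_add [OF q(1)] linear_scale [OF q(1)] inner_add_right algebra_simps)
    define Qs :: "real \<Rightarrow> real^'d^'n" where "Qs s = (\<chi> i. r s (axis i 1))" for s
    \<comment> \<open>On \<open>Y\<close> the map \<open>q\<close> preserves norms, while the added
      term scales them by at most \<open>\<bar>s\<bar> * norm p < 1\<close>. So among the vertex
      parts of \<open>X\<close> only multiples of \<open>a\<close> are annihilated, and the second
      condition rules these out.\<close>
    have good: "inj_on (lift_map (Qs s)) X"
      if s: "\<bar>s\<bar> * norm p < 1" and F: "w0 $ None - (\<Sum>i\<in>UNIV. a $ i * (norm (Qs s $ i))\<^sup>2) \<noteq> 0" for s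
    proof (rule inj)
      fix w assume w: "w \<in> X" "lift_map (Qs s) w = 0"
      then have "lcomb (Qs s) (pr w) = 0" by (simp add: lift_map_def pr_def prod_eq_iff)
      then have "r s (pr w) = 0"
        unfolding Qs_def by (simp add: lcomb_linear_images [OF r])
      moreover have "p \<bullet> pr w = p \<bullet> proj (pr w)"
        using p by (simp add: proj_def inner_diff_right)
      ultimately have "q (proj (pr w)) = - ((s * (p \<bullet> proj (pr w))) *\<^sub>R u)"
        by (simp add: r_def eq_neg_iff_add_eq_0)
      then have "norm (proj (pr w)) = \<bar>s\<bar> * \<bar>p \<bullet> proj (pr w)\<bar>"
        using q(2) [OF proj_Y] w(1) u by (metis imageI norm_minus_cancel norm_scaleR abs_mult mult.right_neutral)
      also have "\<dots> \<le> \<bar>s\<bar> * (norm p * norm (proj (pr w)))"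
        by (intro mult_left_mono Cauchy_Schwarz_ineq2) simp
      finally have "(1 - \<bar>s\<bar> * norm p) * norm (proj (pr w)) \<le> 0"
        by (simp add: algebra_simps)
      then have "norm (proj (pr w)) \<le> 0"
        using s by (simp add: mult_le_0_iff)
      then have "pr w = ((pr w \<bullet> a) / (a \<bullet> a)) *\<^sub>R a" by (simp add: proj_def)
      then obtain c where c: "pr w = c *\<^sub>R a" by blast
      have "pr w = pr (c *\<^sub>R w0)"
        using c w0 by (simp add: linear_scale [OF pr])
      then have w_eq: "w = c *\<^sub>R w0"
        using inj_onD [OF pr_inj] w(1) w0 X by (metis subspace_scale)
      have "a $ i = w0 $ Some i" for i using w0 by (auto simp: pr_def)
      then have "c * (w0 $ None - (\<Sum>i\<in>UNIV. a $ i * (norm (Qs s $ i))\<^sup>2)) = 0"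
        using w(2) by (simp add: lift_map_def w_eq prod_eq_iff sum_distrib_left algebra_simps)
      with F w_eq show "w = 0" by simp
    qed
    \<comment> \<open>This is the last entry of \<open>lift_map (Qs s) w0\<close>, whose first
      component is 0. It is quadratic in \<open>s\<close> with leading coefficient
      \<open>- B\<close>, non-zero by the choice of \<open>p\<close>.\<close>
    define F where "F s = w0 $ None - (\<Sum>i\<in>UNIV. a $ i * (norm (Qs s $ i))\<^sup>2)" for s
    define C where "C = (\<Sum>i\<in>UNIV. a $ i * (p $ i * (Qs 0 $ i \<bullet> u)))"
    define B where "B = (\<Sum>i\<in>UNIV. a $ i * (p $ i)\<^sup>2)"
    have F: "F s = F 0 - 2 * s * C - s\<^sup>2 * B" for s
    proof -
      have "a $ i * (norm (Qs s $ i))\<^sup>2 = a $ i * (norm (Qs 0 $ i))\<^sup>2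
          + 2 * s * (a $ i * (p $ i * (Qs 0 $ i \<bullet> u))) + s\<^sup>2 * (a $ i * (p $ i)\<^sup>2)" for i
      proof -
        have "Qs s $ i = Qs 0 $ i + (s * p $ i) *\<^sub>R u"
          by (simp add: Qs_def r_def inner_axis)
        then have "(norm (Qs s $ i))\<^sup>2 = (norm (Qs 0 $ i))\<^sup>2 + 2 * (s * p $ i) * (Qs 0 $ i \<bullet> u) + (s * p $ i)\<^sup>2"
          using u unfolding power2_norm_eq_inner norm_eq_1
          by (simp add: inner_add_left inner_add_right inner_commute power2_eq_square algebra_simps)
        then show ?thesis by (simp add: power_mult_distrib algebra_simps)
      qed
      then show ?thesis
        by (simp add: F_def C_def B_def sum.distrib sum_distrib_left)
    qed
    define t where "t = 1 / (norm p + 1)"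
    have t: "t > 0" "t * norm p < 1"
      by (simp_all add: t_def add_nonneg_pos)
    \<comment> \<open>Adding the values at \<open>t\<close> and \<open>- t\<close> removes the
      linear term, so zeros at 0, \<open>t\<close> and \<open>- t\<close> would give
      \<open>t\<^sup>2 * B = 0\<close>.\<close>
    have "\<exists>s. \<bar>s\<bar> \<le> t \<and> F s \<noteq> 0"
    proof (rule ccontr)
      assume "\<not> ?thesis"
      then have "F 0 = 0" "F t = 0" "F (- t) = 0"
        using t(1) by auto
      moreover have "F t + F (- t) = 2 * F 0 - 2 * (t\<^sup>2 * B)"
        unfolding F [of t] F [of "- t"] by simp
      ultimately have "t\<^sup>2 * B = 0" by simp
      with t p show False by (simp add: B_def)
    qed
    then obtain s where s: "\<bar>s\<bar> \<le> t" "F s \<noteq> 0" by blast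
    then have "\<bar>s\<bar> * norm p < 1"
      using t(2) mult_right_mono [OF s(1) norm_ge_zero [of p]] by linarith
    then have "inj_on (lift_map (Qs s)) X"
      using s(2) by (intro good) (simp_all add: F_def)
    then show ?thesis by blast
  qed
qed

section \<open>Ranks of all sets of normals\<close>

lemma polynomial_function_lift_map:
  "polynomial_function (\<lambda>Q :: real^'d^'n::finite. lift_map Q w)"
  unfolding polynomial_function_iff_Basis_inner
proof
  fix b :: "(real^'d) \<times> real" assume "b \<in> Basis"
  let ?a = "\<chi> i. w $ Some i"
  have "linear (\<lambda>Q :: real^'d^'n. fst b \<bullet> (2 *\<^sub>R lcomb Q ?a))"
    by (rule linearI)
      (simp_all add: lcomb_def inner_sum_right inner_add_right algebra_simps sum.distrib sum_distrib_left)
  then have fst: "real_polynomial_function (\<lambda>Q :: real^'d^'n. fst b \<bullet> (2 *\<^sub>R lcomb Q ?a))"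
    by (simp add: linear_conv_bounded_linear real_polynomial_function.intros(1))
  have "real_polynomial_function (\<lambda>Q :: real^'d^'n. (norm (Q $ i))\<^sup>2)" for i
  proof -
    have "real_polynomial_function (\<lambda>Q :: real^'d^'n. Q $ i $ k)" for k
      by (intro real_polynomial_function.intros(1) linear_conv_bounded_linear [THEN iffD1] linearI) auto
    then show ?thesis
      unfolding power2_norm_eq_inner inner_vec_def inner_real_def
      by (intro real_polynomial_function_sum real_polynomial_function.intros(4)) auto
  qed
  then have snd: "real_polynomial_function (\<lambda>Q :: real^'d^'n. w $ None + (-1) * (\<Sum>i\<in>UNIV. w $ Some i * (norm (Q $ i))\<^sup>2))"
    by (intro real_polynomial_function.intros(2,3,4) real_polynomial_function_sum) auto
  have "real_polynomial_function (\<lambda>Q :: real^'d^'n. fst b \<bullet> (2 *\<^sub>R lcomb Q ?a) +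
      (w $ None + (-1) * (\<Sum>i\<in>UNIV. w $ Some i * (norm (Q $ i))\<^sup>2)) * snd b)"
    by (rule real_polynomial_function.intros(3) [OF fst real_polynomial_function.intros(4) [OF snd
            real_polynomial_function.intros(2)]])
  moreover have "lift_map Q w \<bullet> b = fst b \<bullet> (2 *\<^sub>R lcomb Q ?a) +
      (w $ None + (-1) * (\<Sum>i\<in>UNIV. w $ Some i * (norm (Q $ i))\<^sup>2)) * snd b" for Q :: "real^'d^'n"
    by (cases b) (simp add: lift_map_def inner_commute)
  ultimately show "real_polynomial_function (\<lambda>Q :: real^'d^'n. lift_map Q w \<bullet> b)"
    by simp
qed

definition normal :: "('e \<Rightarrow> 'n::finite \<times> 'n) \<Rightarrow> ('e \<Rightarrow> real) \<Rightarrow> real^'d^'n \<Rightarrow> 'e option \<Rightarrow> (real^'d) \<times> real" where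
  "normal ends g Q x = lift_map Q (lift_vec ends g x)"

text \<open>The normals represent the truncation of the complete lift matroid to rank
  \<open>d + 1\<close>. All subsets are needed because flats are recognized by comparing the ranks
  of a set and its one-element extensions.\<close>

definition rank_generic :: "'e set \<Rightarrow> ('e \<Rightarrow> 'n::finite \<times> 'n) \<Rightarrow> ('e \<Rightarrow> real) \<Rightarrow> real^'d^'n \<Rightarrow> bool" where
  "rank_generic E ends g Q \<longleftrightarrow>
     (\<forall>S\<in>Pow (ground E). dim (normal ends g Q ` S) = min (lift_rank ends g S) (CARD('d) + 1))"

text \<open>Each edge contributes 1 and -1 to the vertex coordinates and the extra element nothing.
  This is the zero-sum hypothesis of \<open>ex_inj_on_lift_map\<close>.\<close>

lemma sum_span_lift_vec:
  fixes ends :: "'e \<Rightarrow> 'n::finite \<times> 'n"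
  assumes "w \<in> span (lift_vec ends g ` S)"
  shows "(\<Sum>i\<in>UNIV. w $ Some i) = 0"
  using assms
proof (induction rule: span_induct)
  case base
  show ?case
    by (auto simp: subspace_def sum.distrib sum_distrib_left [symmetric])
next
  case (step v)
  then obtain x where v: "v = lift_vec ends g x" by blast
  have ax: "(axis (Some j) 1 :: real^('n option)) $ Some i = (if i = j then 1 else 0)"
    "(axis None 1 :: real^('n option)) $ Some i = 0" for i j :: 'n
    by (simp_all add: axis_def)
  show ?case
    unfolding v by (cases x) (simp_all add: lift_vec_def ax sum_subtractf)
qed

lemma generically_rank_generic:
  fixes ends :: "'e \<Rightarrow> 'n::finite \<times> 'n"
  assumes fin: "finite E" and ne: "\<forall>e\<in>E. fst (ends e) \<noteq> snd (ends e)"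
  shows "generically (rank_generic E ends g :: real^'d^'n \<Rightarrow> bool)"
proof -
  have "generically (\<lambda>Q :: real^'d^'n. dim (normal ends g Q ` S) = min (lift_rank ends g S) (CARD('d) + 1))"
    if S: "S \<subseteq> ground E" for S
  proof -
    let ?X = "span (lift_vec ends g ` S)"
    have finS: "finite S" using S fin by (auto simp: ground_def intro: finite_subset)
    have dimX: "dim ?X = lift_rank ends g S"
      using dim_lift_vec [OF finS, of ends g] S ne by (auto simp: ground_def)
    have "generically (\<lambda>Q :: real^'d^'n. dim (lift_map Q ` ?X) = min (dim ?X) DIM((real^'d) \<times> real))"
    proof (rule generically_dim_image [OF linear_lift_map polynomial_function_lift_map subspace_span])
      fix Y assume Y: "subspace Y" "Y \<subseteq> ?X" "dim Y \<le> DIM((real^'d) \<times> real)"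
      have "(\<Sum>i\<in>UNIV. w $ Some i) = 0" if "w \<in> Y" for w
        using sum_span_lift_vec Y that by blast
      then show "\<exists>Q :: real^'d^'n. inj_on (lift_map Q) Y"
        using Y by (intro ex_inj_on_lift_map) auto
    qed
    then show ?thesis
    proof (rule generically_mono)
      fix Q :: "real^'d^'n"
      assume "dim (lift_map Q ` ?X) = min (dim ?X) DIM((real^'d) \<times> real)"
      moreover have "lift_map Q ` ?X = span (normal ends g Q ` S)"
        by (simp add: linear_span_image [OF linear_lift_map, symmetric] image_image normal_def)
      ultimately show "dim (normal ends g Q ` S) = min (lift_rank ends g S) (CARD('d) + 1)"
        unfolding dimX by simp
    qed
  qed
  moreover have "finite (ground E)" using fin by (simp add: ground_def)
  ultimately have "generically (\<lambda>Q :: real^'d^'n. \<forall>S\<in>Pow (ground E).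
      dim (normal ends g Q ` S) = min (lift_rank ends g S) (CARD('d) + 1))"
    by (intro generically_ball_finite) auto
  then show ?thesis by (rule generically_mono) (simp add: rank_generic_def)
qed

section \<open>Ideal general position\<close>

lemma lcomb_axis: "lcomb Q (axis i 1) = Q $ i"
proof -
  have "lcomb Q (axis i 1) = (\<Sum>j\<in>UNIV. if j = i then Q $ i else 0)"
    unfolding lcomb_def by (rule sum.cong) (auto simp: axis_def)
  then show ?thesis by simp
qed

lemma ideal_pts_eq:
  assumes "\<forall>t\<in>T. card t = 2"
  shows "ideal_pts Q T =
    (\<lambda>x. (x, 0)) ` lcomb Q ` (\<lambda>(i, j). axis j 1 - axis i 1) ` {(i, j). {i, j} \<in> T}"
proof -
  have "{i, j} \<in> T \<and> i \<noteq> j \<longleftrightarrow> {i, j} \<in> T" for i j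
    using assms by fastforce
  then have "ideal_pts Q T = {(Q $ j - Q $ i, 0) | i j. {i, j} \<in> T}"
    unfolding ideal_pts_def by (simp only:)
  also have "\<dots> = (\<lambda>(i, j). (Q $ j - Q $ i, 0)) ` {(i, j). {i, j} \<in> T}"
    by auto
  also have "\<dots> = (\<lambda>x. (x, 0)) ` lcomb Q ` (\<lambda>(i, j). axis j 1 - axis i 1) ` {(i, j). {i, j} \<in> T}"
    by (simp add: image_image case_prod_unfold linear_diff [OF linear_lcomb] lcomb_axis)
  finally show ?thesis .
qed

text \<open>The ideal points are images of edge vectors under \<open>lcomb Q\<close>, so the
  dimension argument applies with target \<open>real^'d\<close>, and an isometry provides the one
  good \<open>Q\<close>.\<close>

lemma generically_IGP: "generically (IGP :: real^'d^'n::finite \<Rightarrow> bool)"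
proof -
  define TT :: "'n set set set" where "TT = {T. \<forall>t\<in>T. card t = 2}"
  define ev :: "'n \<times> 'n \<Rightarrow> real^'n" where "ev = (\<lambda>(i, j). axis j 1 - axis i 1)"
  define pairs :: "'n set set \<Rightarrow> ('n \<times> 'n) set" where "pairs T = {(i, j). {i, j} \<in> T}" for T
  have "generically (\<lambda>Q :: real^'d^'n. dim (ideal_pts Q T) = min (dim (ev ` pairs T)) CARD('d))"
    if T: "T \<in> TT" for T
  proof -
    let ?X = "span (ev ` pairs T)"
    have "linear (\<lambda>Q :: real^'d^'n. lcomb Q a)" for a
      by (rule linearI) (simp_all add: lcomb_def algebra_simps sum.distrib scaleR_sum_right)
    then have "polynomial_function (\<lambda>Q :: real^'d^'n. lcomb Q a)" for a
      by (simp add: linear_conv_bounded_linear polynomial_function_bounded_linear)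
    then have "generically (\<lambda>Q :: real^'d^'n. dim (lcomb Q ` ?X) = min (dim ?X) DIM(real^'d))"
    proof (rule generically_dim_image [OF linear_lcomb _ subspace_span])
      fix Y :: "(real^'n) set" assume Y: "subspace Y" "dim Y \<le> DIM(real^'d)"
      then obtain q :: "real^'n \<Rightarrow> real^'d" where q: "linear q" "\<And>y. y \<in> Y \<Longrightarrow> norm (q y) = norm y"
        using ex_linear_isometry_on [of Y] by auto
      have "inj_on q Y"
        unfolding linear_inj_on_iff_eq_0 [OF q(1) Y(1)] using q(2) by force
      then have "inj_on (lcomb (\<chi> i. q (axis i 1))) Y"
        by (simp add: lcomb_linear_images [OF q(1), abs_def] cong: inj_on_cong)
      then show "\<exists>Q :: real^'d^'n. inj_on (lcomb Q) Y" by blast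
    qed
    then show ?thesis
    proof (rule generically_mono)
      fix Q :: "real^'d^'n"
      assume *: "dim (lcomb Q ` ?X) = min (dim ?X) DIM(real^'d)"
      have "linear (\<lambda>x :: real^'d. (x, 0 :: real))" by (rule linearI) auto
      then have "dim (ideal_pts Q T) = dim (lcomb Q ` ev ` pairs T)"
        using T unfolding TT_def ev_def pairs_def
        by (subst ideal_pts_eq) (auto intro!: dim_image_eq inj_onI)
      with * show "dim (ideal_pts Q T) = min (dim (ev ` pairs T)) CARD('d)"
        by (simp add: linear_span_image [OF linear_lcomb, symmetric])
    qed
  qed
  then have "generically (\<lambda>Q :: real^'d^'n. \<forall>T\<in>TT. dim (ideal_pts Q T) = min (dim (ev ` pairs T)) CARD('d))"
    by (intro generically_ball_finite) auto
  then show ?thesis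
  proof (rule generically_mono)
    fix Q :: "real^'d^'n"
    assume Q: "\<forall>T\<in>TT. dim (ideal_pts Q T) = min (dim (ev ` pairs T)) CARD('d)"
    \<comment> \<open>Distinctness is the rank condition for a graph with a single edge: its edge
      vector is non-zero and \<open>d\<close> is at least 1.\<close>
    have "Q $ i \<noteq> Q $ j" if "i \<noteq> j" for i j
    proof
      assume eq: "Q $ i = Q $ j"
      have T: "{{i, j}} \<in> TT" using that by (simp add: TT_def)
      have "ideal_pts Q {{i, j}} \<subseteq> {0}"
        using eq by (auto simp: ideal_pts_def doubleton_eq_iff zero_prod_def)
      then have "dim (ideal_pts Q {{i, j}}) = 0" by (simp add: dim_eq_0)
      then have "dim (ev ` pairs {{i, j}}) = 0" using Q T by (auto simp: min_def split: if_splits)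
      then have "ev (i, j) = 0" by (auto simp: pairs_def)
      then have "ev (i, j) $ j = 0" by simp
      then show False using that by (simp add: ev_def axis_def)
    qed
    then have "inj (($) Q)" by (auto simp: inj_def)
    moreover have "int (dim (span (ideal_pts Q T))) - 1
        = min (int (CARD('n) - ncomp {(i, j). {i, j} \<in> T})) (int CARD('d)) - 1"
      if "\<forall>t\<in>T. card t = 2" for T
      using Q that dim_edge_vectors [of "pairs T"] by (auto simp: TT_def pairs_def ev_def)
    ultimately show "IGP Q" by (auto simp: IGP_def)
  qed
qed

section \<open>Intersection lattices\<close>

lemma ncomp_insert_connected:
  fixes A :: "('n::finite \<times> 'n) set"
  assumes "e \<in> (A \<union> A\<inverse>)\<^sup>*"
  shows "ncomp (insert e A) = ncomp A"
proof -
  obtain i j where e: "e = (i, j)" by fastforce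
  have "f $ i = f $ j" if f: "\<forall>(i, j)\<in>A. f $ i = f $ j" for f :: "real^'n"
    using assms unfolding e
  proof (induction rule: rtrancl_induct)
    case (step y z)
    then show ?case using f by auto
  qed simp
  then have "{f :: real^'n. \<forall>(i, j)\<in>insert e A. f $ i = f $ j} = {f. \<forall>(i, j)\<in>A. f $ i = f $ j}"
    unfolding e by auto
  then show ?thesis
    by (simp only: dim_constant_on_components [symmetric])
qed

text \<open>The indicator of the component of one endpoint is constant along \<open>A\<close> but
  not along the new edge, so the space of constant functions shrinks.\<close>

lemma ncomp_insert_unconnected:
  fixes A :: "('n::finite \<times> 'n) set"
  assumes e: "e \<notin> (A \<union> A\<inverse>)\<^sup>*"
  shows "ncomp (insert e A) < ncomp A"
proof -
  let ?V = "\<lambda>A. {f :: real^'n. \<forall>(i, j)\<in>A. f $ i = f $ j}"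
  obtain i j where ij: "e = (i, j)" by fastforce
  define h :: "real^'n" where "h = (\<chi> k. if (i, k) \<in> (A \<union> A\<inverse>)\<^sup>* then 1 else 0)"
  have "(i, k) \<in> (A \<union> A\<inverse>)\<^sup>* \<longleftrightarrow> (i, l) \<in> (A \<union> A\<inverse>)\<^sup>*" if "(k, l) \<in> A" for k l
  proof -
    have "(k, l) \<in> A \<union> A\<inverse>" "(l, k) \<in> A \<union> A\<inverse>" using that by auto
    then show ?thesis by (blast intro: rtrancl.rtrancl_into_rtrancl)
  qed
  then have "h \<in> ?V A" by (auto simp: h_def)
  moreover have "h \<notin> ?V (insert e A)"
    using e by (simp add: ij h_def)
  moreover have "?V (insert e A) \<subseteq> ?V A" by auto
  ultimately have "?V (insert e A) \<subset> ?V A" by blast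
  moreover have "subspace (?V B)" for B :: "('n \<times> 'n) set"
    by (simp add: subspace_def case_prod_unfold)
  ultimately have "dim (?V (insert e A)) < dim (?V A)"
    by (intro dim_psubset) (simp only: span_eq_iff [THEN iffD2])
  then show ?thesis
    by (simp only: dim_constant_on_components)
qed

text \<open>Adding \<open>None\<close> raises the rank exactly if \<open>S\<close> is balanced. In
  that case an edge between two components raises it by merging them, and an edge inside a component
  only by destroying balance.\<close>

lemma flat_L0_Some_image:
  fixes ends :: "'e \<Rightarrow> 'n::finite \<times> 'n"
  assumes S: "S \<subseteq> E"
  shows "flat_L0 E ends g (Some ` S) \<longleftrightarrow> balanced_flat E ends g S"
proof -
  let ?r = "lift_rank ends g" and ?n = "CARD('n)"
  have sets: "{e. Some e \<in> Some ` S} = S" "{e. Some e \<in> insert None (Some ` S)} = S"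
    "{e'. Some e' \<in> insert (Some e) (Some ` S)} = insert e S" for e
    by auto
  have r: "?r (Some ` S) = ?n - ncomp (ends ` S) + (if balanced ends g S then 0 else 1)"
    "?r (insert None (Some ` S)) = ?n - ncomp (ends ` S) + 1"
    "?r (insert (Some e) (Some ` S)) = ?n - ncomp (insert (ends e) (ends ` S))
        + (if balanced ends g (insert e S) then 0 else 1)" for e
    unfolding lift_rank_def sets by auto
  have "flat_L0 E ends g (Some ` S) \<longleftrightarrow> ?r (insert None (Some ` S)) > ?r (Some ` S) \<and>
      (\<forall>e\<in>E - S. ?r (insert (Some e) (Some ` S)) > ?r (Some ` S))"
    using S unfolding flat_L0_def ground_def by auto
  also have "\<dots> \<longleftrightarrow> balanced ends g S \<and>
      (\<forall>e\<in>E - S. ?r (insert (Some e) (Some ` S)) > ?n - ncomp (ends ` S))"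
    by (auto simp: r)
  also have "\<dots> \<longleftrightarrow> balanced_flat E ends g S"
  proof -
    have "?r (insert (Some e) (Some ` S)) > ?n - ncomp (ends ` S) \<longleftrightarrow>
        (ends e \<in> ((ends ` S) \<union> (ends ` S)\<inverse>)\<^sup>* \<longrightarrow> \<not> balanced ends g (insert e S))" for e
    proof (cases "ends e \<in> ((ends ` S) \<union> (ends ` S)\<inverse>)\<^sup>*")
      case True
      then show ?thesis by (simp add: r ncomp_insert_connected)
    next
      case False
      then have "ncomp (insert (ends e) (ends ` S)) < ncomp (ends ` S)"
        by (rule ncomp_insert_unconnected)
      with ncomp_le [of "ends ` S"] False show ?thesis by (simp add: r)
    qed
    then show ?thesis using S by (simp add: balanced_flat_def)
  qed
  finally show ?thesis .
qed

section \<open>Annihilators and linear closure\<close>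

definition annih :: "('x \<Rightarrow> 'v::euclidean_space) \<Rightarrow> 'x set \<Rightarrow> 'v set" where
  "annih N A = {y. \<forall>x\<in>A. N x \<bullet> y = 0}"

lemma subspace_annih: "subspace (annih N A)"
  by (auto simp: subspace_def annih_def inner_add_right)

text \<open>Duality: the component of \<open>v\<close> orthogonal to the span lies in the
  annihilator, hence is orthogonal to \<open>v\<close> and to itself. Containment in a hyperplane
  thereby becomes membership of its normal in a span.\<close>

lemma annih_subset_iff:
  "annih N A \<subseteq> {y. v \<bullet> y = 0} \<longleftrightarrow> v \<in> span (N ` A)"
proof
  assume v: "annih N A \<subseteq> {y. v \<bullet> y = 0}"
  obtain y z where yz: "y \<in> span (N ` A)" "\<And>w. w \<in> span (N ` A) \<Longrightarrow> orthogonal z w" "v = y + z"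
    using orthogonal_subspace_decomp_exists [of "N ` A" v] by blast
  have z: "w \<bullet> z = 0" if "w \<in> span (N ` A)" for w
    using yz(2) [OF that] by (simp add: orthogonal_def inner_commute)
  then have "z \<in> annih N A"
    by (simp add: annih_def span_base)
  then have "v \<bullet> z = 0" using v by auto
  moreover have "y \<bullet> z = 0" using yz(1) by (rule z)
  ultimately have "z \<bullet> z = 0" using yz(3) by (simp add: inner_add_left)
  with yz show "v \<in> span (N ` A)" by simp
next
  assume v: "v \<in> span (N ` A)"
  show "annih N A \<subseteq> {y. v \<bullet> y = 0}"
  proof
    fix y assume "y \<in> annih N A"
    then have "orthogonal y v"
      by (intro orthogonal_to_span [OF v]) (auto simp: annih_def orthogonal_def inner_commute)
    then show "y \<in> {y. v \<bullet> y = 0}" by (simp add: orthogonal_def inner_commute)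
  qed
qed

lemma annih_anti_mono: "A \<subseteq> B \<Longrightarrow> annih N B \<subseteq> annih N A"
  by (auto simp: annih_def)

text \<open>The closure operator of the linear matroid represented by \<open>N\<close> on
  \<open>G\<close>; its fixed sets are the flats.\<close>

definition span_closure :: "('x \<Rightarrow> 'v::euclidean_space) \<Rightarrow> 'x set \<Rightarrow> 'x set \<Rightarrow> 'x set" where
  "span_closure N G A = {x\<in>G. N x \<in> span (N ` A)}"

lemma span_closure_superset: "A \<subseteq> G \<Longrightarrow> A \<subseteq> span_closure N G A"
  by (auto simp: span_closure_def span_base)

lemma span_span_closure:
  assumes "A \<subseteq> G"
  shows "span (N ` span_closure N G A) = span (N ` A)"
proof
  show "span (N ` span_closure N G A) \<subseteq> span (N ` A)"
    by (intro span_minimal) (auto simp: span_closure_def)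
  show "span (N ` A) \<subseteq> span (N ` span_closure N G A)"
    by (intro span_mono image_mono span_closure_superset assms)
qed

lemma span_closure_idem: "A \<subseteq> G \<Longrightarrow> span_closure N G (span_closure N G A) = span_closure N G A"
  using span_span_closure [of A G N] by (simp add: span_closure_def)

lemma annih_span_closure:
  assumes "A \<subseteq> G"
  shows "annih N (span_closure N G A) = annih N A"
proof
  show "annih N (span_closure N G A) \<subseteq> annih N A"
    by (intro annih_anti_mono span_closure_superset assms)
  show "annih N A \<subseteq> annih N (span_closure N G A)"
    using annih_subset_iff [of N A] by (auto simp: annih_def span_closure_def)
qed

text \<open>Below rank \<open>d + 1\<close> dimension and matroid rank agree. From rank
  \<open>d + 1\<close> on the normals span the whole space, so the only fixed set left is the ground
  set, the top of the truncation.\<close>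

lemma span_closure_fixed_iff:
  fixes ends :: "'e \<Rightarrow> 'n::finite \<times> 'n" and Q :: "real^'d^'n"
  assumes rk: "rank_generic E ends g Q" and B: "B \<subseteq> ground E"
  shows "span_closure (normal ends g Q) (ground E) B = B \<longleftrightarrow> B \<in> trunc_L0 (CARD('d) + 1) E ends g"
proof -
  let ?N = "normal ends g Q" and ?r = "lift_rank ends g" and ?d = "CARD('d)"
  have rk: "dim (?N ` S) = min (?r S) (?d + 1)" if "S \<subseteq> ground E" for S
    using rk that by (simp add: rank_generic_def)
  have fixed: "span_closure ?N (ground E) B = B \<longleftrightarrow> (\<forall>x\<in>ground E - B. ?N x \<notin> span (?N ` B))"
    using span_closure_superset [OF B, of ?N] by (auto simp: span_closure_def)
  show ?thesis
  proof
    assume "span_closure ?N (ground E) B = B"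
    then have notin: "?N x \<notin> span (?N ` B)" if "x \<in> ground E - B" for x
      using that fixed by blast
    show "B \<in> trunc_L0 (?d + 1) E ends g"
    proof (cases "?r B < ?d + 1")
      case True
      have "?r (insert x B) > ?r B" if x: "x \<in> ground E - B" for x
      proof -
        have "dim (?N ` insert x B) = dim (?N ` B) + 1"
          using notin [OF x] by (simp add: dim_insert)
        then show ?thesis
          using rk [of B] rk [of "insert x B"] B x True by auto
      qed
      then show ?thesis using True B by (simp add: trunc_L0_def flat_L0_def)
    next
      case False
      then have "dim (?N ` B) = DIM((real^'d) \<times> real)" using rk [OF B] by simp
      then have "span (?N ` B) = UNIV" by (simp only: dim_eq_full)
      then have "B = ground E" using notin B by auto
      then show ?thesis by (simp add: trunc_L0_def)
    qed
  next
    assume B': "B \<in> trunc_L0 (?d + 1) E ends g"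
    have "?N x \<notin> span (?N ` B)" if x: "x \<in> ground E - B" for x
    proof
      assume "?N x \<in> span (?N ` B)"
      then have "dim (?N ` insert x B) = dim (?N ` B)" by (simp add: dim_insert)
      \<comment> \<open>The element \<open>x\<close> outside \<open>B\<close> excludes the top. As
        the rank of \<open>B\<close> is at most \<open>d\<close>, cutting off at
        \<open>d + 1\<close> does not hide the increase.\<close>
      moreover have "?r (insert x B) > ?r B" "?r B < ?d + 1"
        using B' x by (auto simp: trunc_L0_def flat_L0_def)
      ultimately show False using rk [of B] rk [of "insert x B"] B x by auto
    qed
    then show "span_closure ?N (ground E) B = B" using fixed by blast
  qed
qed

section \<open>Homogeneous equations of the hyperplanes\<close>

lemma normal_None: "normal ends g Q None = (0, 1)"
proof -
  have "(\<chi> i. axis None 1 $ Some i) = (0 :: real^'c)" by (simp add: vec_eq_iff axis_def)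
  then show ?thesis
    using linear_0 [OF linear_lcomb] by (simp add: normal_def lift_vec_def lift_map_def axis_def)
qed

lemma normal_Some:
  "normal ends g Q (Some e) = (2 *\<^sub>R (Q $ snd (ends e) - Q $ fst (ends e)),
     (norm (Q $ fst (ends e)))\<^sup>2 - (norm (Q $ snd (ends e)))\<^sup>2 - g e)"
proof -
  let ?w = "lift_vec ends g (Some e)"
  have w: "?w $ Some i = (axis (snd (ends e)) 1 - axis (fst (ends e)) 1) $ i" "?w $ None = - g e" for i
    by (simp_all add: lift_vec_def axis_def)
  have "(\<chi> i. ?w $ Some i) = axis (snd (ends e)) 1 - axis (fst (ends e)) 1"
    by (simp add: vec_eq_iff w)
  moreover have "(\<Sum>i\<in>UNIV. ?w $ Some i * (norm (Q $ i))\<^sup>2)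
      = (axis (snd (ends e)) 1 - axis (fst (ends e)) 1) \<bullet> (\<chi> i. (norm (Q $ i))\<^sup>2)"
    by (simp add: inner_vec_def w)
  ultimately show ?thesis
    unfolding normal_def lift_map_def w(2)
    by (simp add: linear_diff [OF linear_lcomb] lcomb_axis inner_diff_left inner_axis')
qed

lemma mem_hyp_iff: "P \<in> hyp ends g Q e \<longleftrightarrow> normal ends g Q (Some e) \<bullet> (P, 1) = 0"
  by (auto simp: hyp_def phi_def normal_Some dist_norm power2_norm_eq_inner inner_diff_left
      inner_diff_right inner_commute algebra_simps)

text \<open>A point with last coordinate 1 suffices to recover a linear form on a subspace from its
  restriction to the points with last coordinate 1.\<close>

lemma vanish_on_subspace_if_affine:
  fixes Z :: "('a::real_inner \<times> real) set"
  assumes Z: "subspace Z" and P0: "(P0, 1) \<in> Z" and v: "\<And>P. (P, 1) \<in> Z \<Longrightarrow> v \<bullet> (P, 1) = 0"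
  shows "Z \<subseteq> {y. v \<bullet> y = 0}"
proof
  fix y assume y: "y \<in> Z"
  define z where "z = y + (1 - snd y) *\<^sub>R (P0, 1)"
  have "z \<in> Z" unfolding z_def by (intro subspace_add subspace_scale Z y P0)
  moreover have "z = (fst z, 1)" by (simp add: z_def prod_eq_iff)
  ultimately have "v \<bullet> z = 0" using v by metis
  then show "y \<in> {y. v \<bullet> y = 0}"
    unfolding z_def inner_add_right inner_scaleR_right using v [OF P0] by simp
qed

text \<open>Distinct points give a non-zero linear part, so the affine hyperplane contains a point
  \<open>P0\<close>. A vector of the kernel is then a combination of two of its vectors with last
  coordinate 1.\<close>

lemma pclos_hyp:
  assumes "Q $ fst (ends e) \<noteq> Q $ snd (ends e)"
  shows "pclos (hyp ends g Q e) = {y. normal ends g Q (Some e) \<bullet> y = 0}" (is "_ = ?K")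
proof
  let ?v = "normal ends g Q (Some e)"
  have K: "subspace ?K" by (auto simp: subspace_def inner_add_right)
  show "pclos (hyp ends g Q e) \<subseteq> ?K"
    unfolding pclos_def using K by (intro span_minimal) (auto simp: mem_hyp_iff)
  show "?K \<subseteq> pclos (hyp ends g Q e)"
  proof
    fix y assume y: "y \<in> ?K"
    have "fst ?v \<noteq> 0" using assms by (simp add: normal_Some)
    \<comment> \<open>The foot of the perpendicular from the origin to the hyperplane.\<close>
    define P0 where "P0 = (- snd ?v / (fst ?v \<bullet> fst ?v)) *\<^sub>R fst ?v"
    have P0: "?v \<bullet> (P0, 1) = 0"
      using \<open>fst ?v \<noteq> 0\<close> by (cases ?v) (simp add: P0_def)
    define z where "z = y + (1 - snd y) *\<^sub>R (P0, 1)"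
    obtain w where w: "z = (w, 1)"
      by (cases z) (simp add: z_def prod_eq_iff)
    have "?v \<bullet> z = 0"
      unfolding z_def inner_add_right inner_scaleR_right using y P0 by simp
    then have "w \<in> hyp ends g Q e" "P0 \<in> hyp ends g Q e"
      using P0 by (simp_all add: mem_hyp_iff w)
    then have "z \<in> pclos (hyp ends g Q e)" "(P0, 1) \<in> pclos (hyp ends g Q e)"
      unfolding pclos_def w by (auto intro!: span_base)
    moreover have "y = z - (1 - snd y) *\<^sub>R (P0, 1)" by (simp add: z_def)
    ultimately show "y \<in> pclos (hyp ends g Q e)"
      unfolding pclos_def by (metis span_diff span_scale)
  qed
qed

text \<open>Intersections are annihilators of sets of normals, and by duality \<open>Pmap\<close>
  sends the annihilator of \<open>A\<close> to the closure of \<open>A\<close>. So the lattice is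
  that of the closed sets.\<close>

lemma rank_generic_imp_PGP:
  fixes ends :: "'e \<Rightarrow> 'n::finite \<times> 'n" and Q :: "real^'d^'n"
  assumes rk: "rank_generic E ends g Q" and def: "arr_defined E ends Q"
  shows "PGP E ends g Q"
proof -
  let ?N = "normal ends g Q" and ?G = "ground E"
  let ?cl = "span_closure ?N ?G"
  define K where "K x = {y. ?N x \<bullet> y = 0}" for x
  have hinf: "hinf = K None"
    by (auto simp: hinf_def K_def normal_None)
  have K_Some: "pclos (hyp ends g Q e) = K (Some e)" if "e \<in> E" for e
    using def that unfolding K_def arr_defined_def by (intro pclos_hyp) auto
  have HP: "HP E ends g Q = K ` ?G"
    unfolding HP_def ground_def hinf by (simp add: K_Some image_image)
  have annih_eq: "annih ?N A = \<Inter> (K ` A)" for A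
    by (auto simp: annih_def K_def)
  \<comment> \<open>Different edges may define the same hyperplane, so subfamilies are described as
    images of subsets of the ground set.\<close>
  have LP: "LP E ends g Q = annih ?N ` Pow ?G"
  proof -
    have "LP E ends g Q = (\<Inter>) ` Pow (K ` ?G)"
      unfolding LP_def HP by auto
    also have "Pow (K ` ?G) = (`) K ` Pow ?G"
      by (rule image_Pow_surj [OF refl, symmetric])
    finally show ?thesis by (simp add: image_image annih_eq)
  qed
  have Pmap: "Pmap E ends g Q (annih ?N A) = ?cl A" for A
  proof -
    have "Pmap E ends g Q x = {k\<in>?G. x \<subseteq> K k}" for x
      unfolding Pmap_def ground_def hinf using K_Some by auto
    then show ?thesis
      using annih_subset_iff [of ?N A] by (simp add: K_def span_closure_def)
  qed
  have order: "annih ?N B \<subseteq> annih ?N A \<longleftrightarrow> ?cl A \<subseteq> ?cl B" if "A \<subseteq> ?G" "B \<subseteq> ?G" for A B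
  proof
    assume "annih ?N B \<subseteq> annih ?N A"
    then show "?cl A \<subseteq> ?cl B"
      unfolding span_closure_def annih_subset_iff [symmetric] by auto
  next
    assume "?cl A \<subseteq> ?cl B"
    then have "annih ?N (?cl B) \<subseteq> annih ?N (?cl A)" by (rule annih_anti_mono)
    then show "annih ?N B \<subseteq> annih ?N A" using that by (simp add: annih_span_closure)
  qed
  have inj: "inj_on (Pmap E ends g Q) (LP E ends g Q)"
  proof (rule inj_onI)
    fix x y assume "x \<in> LP E ends g Q" "y \<in> LP E ends g Q" and eq: "Pmap E ends g Q x = Pmap E ends g Q y"
    then obtain A B where AB: "A \<subseteq> ?G" "B \<subseteq> ?G" "x = annih ?N A" "y = annih ?N B" by (auto simp: LP)
    then have "?cl A = ?cl B" using eq by (simp add: Pmap)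
    then show "x = y" using order [of A B] order [of B A] AB by (simp add: subset_antisym)
  qed
  have img: "Pmap E ends g Q ` LP E ends g Q = trunc_L0 (CARD('d) + 1) E ends g"
  proof -
    have "Pmap E ends g Q ` LP E ends g Q = ?cl ` Pow ?G"
      by (simp add: LP image_image Pmap)
    also have "\<dots> = {B. B \<subseteq> ?G \<and> ?cl B = B}"
    proof
      have "?cl A \<subseteq> ?G" for A by (auto simp: span_closure_def)
      then show "?cl ` Pow ?G \<subseteq> {B. B \<subseteq> ?G \<and> ?cl B = B}" using span_closure_idem [of _ ?G ?N] by auto
      show "{B. B \<subseteq> ?G \<and> ?cl B = B} \<subseteq> ?cl ` Pow ?G" by force
    qed
    also have "\<dots> = {B. B \<subseteq> ?G \<and> B \<in> trunc_L0 (CARD('d) + 1) E ends g}"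
      using span_closure_fixed_iff [OF rk] by blast
    also have "\<dots> = trunc_L0 (CARD('d) + 1) E ends g"
      by (auto simp: trunc_L0_def flat_L0_def)
    finally show ?thesis .
  qed
  show ?thesis
    unfolding PGP_def bij_betw_def using def inj img order by (auto simp: LP Pmap)
qed

text \<open>An affine intersection is the slice at height 1 of an annihilator. The non-empty slices
  belong to the closed sets without \<open>None\<close>, and these are the balanced flats of rank at
  most \<open>d\<close>.\<close>

lemma rank_generic_imp_GP:
  fixes ends :: "'e \<Rightarrow> 'n::finite \<times> 'n" and Q :: "real^'d^'n"
  assumes rk: "rank_generic E ends g Q" and def: "arr_defined E ends Q"
  shows "GP E ends g Q"
proof -
  let ?N = "normal ends g Q" and ?G = "ground E"
  let ?cl = "span_closure ?N ?G"
  let ?Z = "\<lambda>A. annih ?N (Some ` A)"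
  let ?Es = "Esub E ends g Q"
  define aff where "aff A = {P. (P, 1) \<in> ?Z A}" for A
  have aff_eq: "aff = (\<lambda>A. \<Inter> (hyp ends g Q ` A))"
    by (auto simp: fun_eq_iff aff_def annih_def mem_hyp_iff)
  have LH: "LH E ends g Q = {s \<in> aff ` Pow E. s \<noteq> {}}"
  proof -
    have "LH E ends g Q = {s \<in> (\<Inter>) ` Pow (hyp ends g Q ` E). s \<noteq> {}}"
      unfolding LH_def by auto
    also have "Pow (hyp ends g Q ` E) = (`) (hyp ends g Q) ` Pow E"
      by (rule image_Pow_surj [OF refl, symmetric])
    finally show ?thesis by (simp only: image_image aff_eq)
  qed
  have sub_G: "Some ` A \<subseteq> ?G" if "A \<subseteq> E" for A
    using that by (auto simp: ground_def)
  \<comment> \<open>A vector of the annihilator with non-zero last coordinate can be scaled to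
    height 1, so an empty slice means containment in the ideal hyperplane.\<close>
  have None_cl: "None \<in> ?cl (Some ` A) \<longleftrightarrow> aff A = {}" if "A \<subseteq> E" for A
  proof -
    have "None \<in> ?cl (Some ` A) \<longleftrightarrow> ?Z A \<subseteq> {y. snd y = 0}"
      using annih_subset_iff [of ?N "Some ` A" "?N None"]
      by (simp add: span_closure_def ground_def normal_None inner_prod_def)
    also have "\<dots> \<longleftrightarrow> aff A = {}"
    proof
      assume "aff A = {}"
      show "?Z A \<subseteq> {y. snd y = 0}"
      proof (rule subsetI, rule ccontr)
        fix y assume y: "y \<in> ?Z A" "y \<notin> {y. snd y = 0}"
        then have "(1 / snd y) *\<^sub>R y \<in> ?Z A" by (intro subspace_scale subspace_annih) simp
        moreover have "(1 / snd y) *\<^sub>R y = ((1 / snd y) *\<^sub>R fst y, 1)" using y by (simp add: prod_eq_iff)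
        ultimately show False using \<open>aff A = {}\<close> by (auto simp: aff_def)
      qed
    qed (auto simp: aff_def)
    finally show ?thesis .
  qed
  have Esub: "Some ` ?Es (aff A) = ?cl (Some ` A)" if A: "A \<subseteq> E" "aff A \<noteq> {}" for A
  proof -
    obtain P0 where P0: "(P0, 1) \<in> ?Z A" using A(2) by (auto simp: aff_def)
    have "aff A \<subseteq> hyp ends g Q e \<longleftrightarrow> ?N (Some e) \<in> span (?N ` Some ` A)" for e
    proof -
      have "aff A \<subseteq> hyp ends g Q e \<longleftrightarrow> (\<forall>P. (P, 1) \<in> ?Z A \<longrightarrow> ?N (Some e) \<bullet> (P, 1) = 0)"
        by (auto simp: aff_def mem_hyp_iff)
      also have "\<dots> \<longleftrightarrow> ?Z A \<subseteq> {y. ?N (Some e) \<bullet> y = 0}"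
        using vanish_on_subspace_if_affine [OF subspace_annih P0] by blast
      finally show ?thesis by (simp only: annih_subset_iff)
    qed
    then have "?Es (aff A) = {e\<in>E. Some e \<in> ?cl (Some ` A)}"
      by (auto simp: Esub_def span_closure_def ground_def)
    moreover have "?cl (Some ` A) \<subseteq> Some ` E"
      using None_cl [OF A(1)] A(2) by (auto simp: span_closure_def ground_def)
    ultimately show ?thesis by auto
  qed
  \<comment> \<open>Passing to the closure does not change the annihilator, hence not the
    slice.\<close>
  have aff_Esub: "aff (?Es (aff A)) = aff A" if "A \<subseteq> E" "aff A \<noteq> {}" for A
    using that by (simp add: aff_def [of "?Es (aff A)"] Esub annih_span_closure sub_G) (simp add: aff_def)
  have aff_anti: "aff B \<subseteq> aff A" if "A \<subseteq> B" for A B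
    using that by (auto simp: aff_eq)
  have order: "aff B \<subseteq> aff A \<longleftrightarrow> ?Es (aff A) \<subseteq> ?Es (aff B)"
    if "A \<subseteq> E" "aff A \<noteq> {}" "B \<subseteq> E" "aff B \<noteq> {}" for A B
  proof
    assume "aff B \<subseteq> aff A"
    then show "?Es (aff A) \<subseteq> ?Es (aff B)" by (auto simp: Esub_def)
  next
    assume "?Es (aff A) \<subseteq> ?Es (aff B)"
    then have "aff (?Es (aff B)) \<subseteq> aff (?Es (aff A))" by (rule aff_anti)
    then show "aff B \<subseteq> aff A" using that by (simp add: aff_Esub)
  qed
  have flats: "balanced_flat E ends g S \<and> CARD('n) - ncomp (ends ` S) \<le> CARD('d) \<longleftrightarrow>
      S \<subseteq> E \<and> ?cl (Some ` S) = Some ` S" for S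
  proof (cases "S \<subseteq> E")
    case True
    have "{e. Some e \<in> Some ` S} = S" by auto
    then have r: "lift_rank ends g (Some ` S) = CARD('n) - ncomp (ends ` S)" if "balanced ends g S"
      using that by (auto simp: lift_rank_def)
    \<comment> \<open>The top of the truncation contains \<open>None\<close>, so only flats of rank
      at most \<open>d\<close> remain.\<close>
    have "Some ` S \<noteq> ?G" by (auto simp: ground_def)
    then have "?cl (Some ` S) = Some ` S \<longleftrightarrow>
        flat_L0 E ends g (Some ` S) \<and> lift_rank ends g (Some ` S) < CARD('d) + 1"
      unfolding span_closure_fixed_iff [OF rk sub_G [OF True]] by (simp add: trunc_L0_def)
    also have "\<dots> \<longleftrightarrow> balanced_flat E ends g S \<and> lift_rank ends g (Some ` S) < CARD('d) + 1"
      by (simp only: flat_L0_Some_image [OF True])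
    also have "\<dots> \<longleftrightarrow> balanced_flat E ends g S \<and> CARD('n) - ncomp (ends ` S) \<le> CARD('d)"
      using r by (auto simp: balanced_flat_def)
    finally show ?thesis using True by blast
  qed (simp add: balanced_flat_def)
  have inj: "inj_on ?Es (LH E ends g Q)"
  proof (rule inj_onI)
    fix s t assume "s \<in> LH E ends g Q" "t \<in> LH E ends g Q" and eq: "?Es s = ?Es t"
    then obtain A B where AB: "A \<subseteq> E" "aff A \<noteq> {}" "B \<subseteq> E" "aff B \<noteq> {}" "s = aff A" "t = aff B"
      by (auto simp: LH)
    then show "s = t" using order [of A B] order [of B A] eq by (simp add: subset_antisym)
  qed
  have img: "?Es ` LH E ends g Q = {S. S \<subseteq> E \<and> ?cl (Some ` S) = Some ` S}"
  proof (intro subset_antisym subsetI)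
    fix S assume "S \<in> ?Es ` LH E ends g Q"
    then obtain A where A: "A \<subseteq> E" "aff A \<noteq> {}" "S = ?Es (aff A)" by (auto simp: LH)
    then show "S \<in> {S. S \<subseteq> E \<and> ?cl (Some ` S) = Some ` S}"
      by (simp add: Esub span_closure_idem sub_G) (auto simp: Esub_def)
  next
    fix S assume "S \<in> {S. S \<subseteq> E \<and> ?cl (Some ` S) = Some ` S}"
    then have S: "S \<subseteq> E" "?cl (Some ` S) = Some ` S" by auto
    then have ne: "aff S \<noteq> {}" using None_cl [OF S(1)] by auto
    then have "Some ` ?Es (aff S) = Some ` S" using Esub S by simp
    then have "?Es (aff S) = S" by (simp add: inj_image_eq_iff)
    then show "S \<in> ?Es ` LH E ends g Q" using S(1) ne by (intro image_eqI [of _ _ "aff S"]) (simp_all add: LH)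
  qed
  show ?thesis
    unfolding GP_def bij_betw_def flats
  proof (intro conjI ballI def inj img)
    fix s t assume "s \<in> LH E ends g Q" "t \<in> LH E ends g Q"
    then obtain A B where "A \<subseteq> E" "aff A \<noteq> {}" "B \<subseteq> E" "aff B \<noteq> {}" "s = aff A" "t = aff B"
      by (auto simp: LH)
    then show "t \<subseteq> s \<longleftrightarrow> ?Es s \<subseteq> ?Es t" using order [of A B] by simp
  qed
qed

theorem theorem6p1:
  fixes E :: "'e set" and ends :: "'e \<Rightarrow> 'n::finite \<times> 'n" and g :: "'e \<Rightarrow> real"
  assumes "finite E"
    and "\<forall>e\<in>E. fst (ends e) \<noteq> snd (ends e)"
    and "CARD('n) > CARD('d)"
  shows "\<exists>U :: (real^'d^'n) set. open U \<and> closure U = UNIV \<and>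
           U \<subseteq> {Q. IGP Q \<and> GP E ends g Q \<and> PGP E ends g Q}"
proof -
  have "generically (\<lambda>Q :: real^'d^'n. IGP Q \<and> rank_generic E ends g Q)"
    using generically_IGP generically_rank_generic [OF assms(1,2)] by (rule generically_conj)
  then have "generically (\<lambda>Q :: real^'d^'n. IGP Q \<and> GP E ends g Q \<and> PGP E ends g Q)"
  proof (rule generically_mono)
    fix Q :: "real^'d^'n" assume Q: "IGP Q \<and> rank_generic E ends g Q"
    then have "arr_defined E ends Q"
      using assms(2) by (auto simp: arr_defined_def IGP_def inj_def)
    with Q show "IGP Q \<and> GP E ends g Q \<and> PGP E ends g Q"
      using rank_generic_imp_GP rank_generic_imp_PGP by blast
  qed
  then show ?thesis by (simp add: generically_def)
qed

end
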